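(* Let $\mathbb{K}$ be a field of characteristic zero and $\alpha\in\mathbb{K}^\times$. The automorphism of the Weyl algebra $\mathbf{K}\langle\mathbf{q},\mathbf{p}\rangle/(\mathbf{p}\mathbf{q}-\mathbf{q}\mathbf{p}=\hbar)\cong(A_\alpha,\star)$ induced by the action of $1\in\mathbb{Z}$ by translation on $\mathcal{O}^q_\alpha$ is given by $$\mathbf{q}\longmapsto\frac{\alpha+\alpha^{-1}}{2}\,\mathbf{q}+\mathbf{p}\qquad\text{and}\qquad\mathbf{p}\longmapsto\left(\frac{\alpha-\alpha^{-1}}{2}\right)^2\mathbf{q}+\frac{\alpha+\alpha^{-1}}{2}\,\mathbf{p}.$$
   Context: For a set $S$, $\mathrm{Map}(S,\mathbb{K})$ is the vector space of functions $S\to\mathbb{K}$; for $S\subset T$, functions on $S$ are identified with functions on $T$ supported in $S$ (extension by $0$). $\delta_x$ denotes the function equal to $1$ at $x$ and $0$ elsewhere. Cochain complexes have differential of degree $+1$. Scalars: either $\hbar\in\mathbb{K}^\times$ and $\mathbf{K}=\mathbb{K}$, or $\hbar$ is a formal parameter and $\mathbf{K}=\mathbb{K}[\hbar]$ or $\mathbb{K}[\![\hbar]\!]$. Scalars are extended to $\mathbf{K}$ throughout. The operator $Q_\alpha$ on $\mathrm{Map}(\mathbb{Z},\mathbb{K})$ is $(Q_\alpha h)(x)=h(x-1)-(\alpha+\alpha^{-1})h(x)+h(x+1)$. For $a<b$ real, $\mathbb{V}_\alpha(a,b)$ is the cone of $Q_\alpha:\mathrm{Map}(\mathbb{Z}\cap(a+1,b-1),\mathbb{K})\to\mathrm{Map}(\mathbb{Z}\cap(a,b),\mathbb{K})$,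 i.e. the two-term complex with source in degree $-1$, target in degree $0$. An element $g$ of the source, seen in degree $-1$, is written $\overline{g}$, so the differential is $d\overline{g}=Q_\alpha g$. Thus $\mathrm{Sym}(\mathbb{V}_\alpha(a,b))$ is the free graded commutative algebra on degree $0$ generators $\delta_x$ ($x\in\mathbb{Z}\cap(a,b)$) and degree $-1$ generators $\overline{\delta}_x$ ($x\in\mathbb{Z}\cap(a+1,b-1)$); $d$ is extended by the Leibniz rule. Put $\Delta=\sum_x\frac{\partial^2}{\partial\overline{\delta}_x\partial\delta_x}$ (sum over integers $x\in(a+1,b-1)$), $d_\hbar=d+\hbar\Delta$, and $\mathcal{O}^q_\alpha(a,b)=(\mathrm{Sym}(\mathbb{V}_\alpha(a,b)),d_\hbar)$. Write $[\,\cdot\,]$ for classes in $H^0$. For intervals of length greater than $2$, inclusions $I\subset J$ induce quasi-isomorphisms $\mathcal{O}^q_\alpha(I)\to\mathcal{O}^q_\alpha(J)$, and for disjoint $I_1,I_2\subset J$ multiplication is a chain map $\mathcal{O}^q_\alpha(I_1)\otimes\mathcal{O}^q_\alpha(I_2)\to\mathcal{O}^q_\alpha(J)$ (the factorization product). Let $J=(-4,4)$ and $A_\alpha=H^0(\mathcal{O}^q_\alpha(J))$. The product $\star$ on $A_\alpha$ is the composition $A_\alpha\otimes A_\alpha\cong H^0(\mathcal{O}^q_\alpha(I_1))\otimes H^0(\mathcal{O}^q_\alpha(I_2))\to A_\alpha$ of the inverses of the isomorphisms induced by the inclusions with the factorization product, for any disjoint open intervals $I_1,I_2\subset J$ of length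 greater than $2$ with $I_1$ to the left of $I_2$ (it does not depend on this choice). The Weyl algebra $\mathbf{K}\langle\mathbf{q},\mathbf{p}\rangle/(\mathbf{p}\mathbf{q}-\mathbf{q}\mathbf{p}=\hbar)$ is identified with $(A_\alpha,\star)$ via the algebra isomorphism $\mathbf{q}\mapsto[\delta_0]$, $\mathbf{p}\mapsto\frac12[\delta_1-\delta_{-1}]$. Translation action: $n\in\mathbb{Z}$ acts by the isomorphisms $\mathcal{O}^q_\alpha(I)\to\mathcal{O}^q_\alpha(I+n)$ induced by $f\mapsto(x\mapsto f(x-n))$; so $1\in\mathbb{Z}$ sends $\delta_x\mapsto\delta_{x+1}$ and $\overline{\delta}_x\mapsto\overline{\delta}_{x+1}$. The induced automorphism of $A_\alpha$ is the composition $H^0(\mathcal{O}^q_\alpha(J))\to H^0(\mathcal{O}^q_\alpha(J+1))\cong H^0(\mathcal{O}^q_\alpha(J'))\cong H^0(\mathcal{O}^q_\alpha(J))$, where the first map is the translation by $1$, $J'$ is any bounded open interval containing $J\cup(J+1)$, e.g. $(-4,5)$, and the isomorphisms are those induced by the inclusions $J+1\subset J'\supset J$. *)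

theory Defs
  imports
    Complex_Main
    "HOL-Library.FSet"
    "HOL-Library.Poly_Mapping"
    "HOL-Computational_Algebra.Polynomial"
    "HOL-Computational_Algebra.Formal_Power_Series"
    "HOL-Algebra.QuotRing"
    "HOL-Algebra.Module"
    "HOL-Algebra.Algebraic_Closure_Type"
begin

section \<open>Scalars\<close>

definition unital_ring_hom :: "('a::ring_1 \<Rightarrow> 'b::ring_1) \<Rightarrow> bool" where
  "unital_ring_hom e \<longleftrightarrow>
     e 1 = 1 \<and> (\<forall>x y. e (x + y) = e x + e y) \<and> (\<forall>x y. e (x * y) = e x * e y)"

text \<open>
  The extended scalars are a ring \<open>'r\<close> with structure map \<open>\<kappa>\<close> from the base field \<open>'k\<close> and a
  distinguished element \<open>hbar\<close>. Up to isomorphism, the triple is one of: \<open>'k\<close> itself with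
  \<open>hbar\<close> a nonzero scalar; the polynomial ring in the variable \<open>hbar\<close>; the power series ring in
  the variable \<open>hbar\<close>.
\<close>

definition scalar_extension :: "('k::field_char_0 \<Rightarrow> 'r::comm_ring_1) \<Rightarrow> 'r \<Rightarrow> bool" where
  "scalar_extension \<kappa> hbar \<longleftrightarrow> unital_ring_hom \<kappa> \<and>
     ((bij \<kappa> \<and> hbar \<noteq> 0) \<or>
      (\<exists>e :: 'k poly \<Rightarrow> 'r. unital_ring_hom e \<and> bij e \<and>
          (\<forall>c. e [:c:] = \<kappa> c) \<and> e [:0, 1:] = hbar) \<or>
      (\<exists>e :: 'k fps \<Rightarrow> 'r. unital_ring_hom e \<and> bij e \<and>
          (\<forall>c. e (fps_const c) = \<kappa> c) \<and> e fps_X = hbar))"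


section \<open>The free graded commutative algebra\<close>

definition sites :: "real \<Rightarrow> real \<Rightarrow> int set" where
  "sites a b = {x. a < real_of_int x \<and> real_of_int x < b}"

text \<open>
  Polynomials over \<open>'r\<close> in the even variables \<open>\<delta>\<^sub>x\<close>, \<open>x\<close> an integer; multiplication is that of
  the library.
\<close>

type_synonym 'r pol = "(int \<Rightarrow>\<^sub>0 nat) \<Rightarrow>\<^sub>0 'r"

text \<open>
  An element \<open>f\<close> stands for the sum over \<open>S = {x\<^sub>1 < \<dots> < x\<^sub>k}\<close> of \<open>lookup f S\<close> times the product of
  the odd generators at \<open>x\<^sub>1\<close>, \dots, \<open>x\<^sub>k\<close>, taken in this order. All the algebras for varying
  intervals are subspaces of this one type, so that the map induced by an inclusion of intervals
  is the identity on underlying elements.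
\<close>

type_synonym 'r sym = "int fset \<Rightarrow>\<^sub>0 'r pol"

definition Sym :: "real \<Rightarrow> real \<Rightarrow> 'r::comm_ring_1 sym set" where
  "Sym a b = {f. \<forall>S \<in> Poly_Mapping.keys f.
     fset S \<subseteq> sites (a + 1) (b - 1) \<and>
     (\<forall>m \<in> Poly_Mapping.keys (Poly_Mapping.lookup f S). Poly_Mapping.keys m \<subseteq> sites a b)}"

definition Sym_deg :: "real \<Rightarrow> real \<Rightarrow> int \<Rightarrow> 'r::comm_ring_1 sym set" where
  "Sym_deg a b k = {f \<in> Sym a b. \<forall>S \<in> Poly_Mapping.keys f. - int (fcard S) = k}"

definition scalar :: "'r \<Rightarrow> 'r::comm_ring_1 sym" where
  "scalar c = Poly_Mapping.single {||} (Poly_Mapping.single 0 c)"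

definition delta :: "int \<Rightarrow> int \<Rightarrow> 'r::comm_ring_1" where
  "delta x = (\<lambda>y. if y = x then 1 else 0)"

text \<open>
  A finitely supported function on the integers as a linear element of degree \<open>0\<close>; in particular
  \<open>lin (delta x)\<close> is the generator \<open>\<delta>\<^sub>x\<close>.
\<close>

definition lin :: "(int \<Rightarrow> 'r) \<Rightarrow> 'r::comm_ring_1 sym" where
  "lin g = Poly_Mapping.single {||}
     (\<Sum>x | g x \<noteq> 0. Poly_Mapping.single (Poly_Mapping.single x 1) (g x))"

definition shuffle_sign :: "int fset \<Rightarrow> int fset \<Rightarrow> 'a::comm_ring_1" where
  "shuffle_sign S T = (- 1) ^ card {(s, t). s \<in> fset S \<and> t \<in> fset T \<and> t < s}"

definition smul :: "'r::comm_ring_1 sym \<Rightarrow> 'r sym \<Rightarrow> 'r sym"  (infixl \<open>\<cdot>\<^sub>s\<close> 70) where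
  "f \<cdot>\<^sub>s g = (\<Sum>S \<in> Poly_Mapping.keys f. \<Sum>T \<in> Poly_Mapping.keys g.
     if S |\<inter>| T = {||}
     then Poly_Mapping.single (S |\<union>| T)
            (shuffle_sign S T * Poly_Mapping.lookup f S * Poly_Mapping.lookup g T)
     else 0)"

definition pol_partial :: "int \<Rightarrow> 'r::comm_ring_1 pol \<Rightarrow> 'r pol" where
  "pol_partial x P = (\<Sum>m \<in> Poly_Mapping.keys P.
     Poly_Mapping.single (m - Poly_Mapping.single x 1)
       (of_nat (Poly_Mapping.lookup m x) * Poly_Mapping.lookup P m))"

definition even_partial :: "int \<Rightarrow> 'r::comm_ring_1 sym \<Rightarrow> 'r sym" where
  "even_partial x f = (\<Sum>S \<in> Poly_Mapping.keys f.
     Poly_Mapping.single S (pol_partial x (Poly_Mapping.lookup f S)))"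

text \<open>The left derivative with respect to the odd generator at \<open>x\<close>, a derivation of degree \<open>1\<close>.\<close>

definition odd_partial :: "int \<Rightarrow> 'r::comm_ring_1 sym \<Rightarrow> 'r sym" where
  "odd_partial x f = (\<Sum>S \<in> {S \<in> Poly_Mapping.keys f. x |\<in>| S}.
     Poly_Mapping.single (S |-| {|x|})
       ((- 1) ^ card {y \<in> fset S. y < x} * Poly_Mapping.lookup f S))"


section \<open>The quantum observables\<close>

definition Q_op :: "('k::field_char_0 \<Rightarrow> 'r::comm_ring_1) \<Rightarrow> 'k \<Rightarrow> (int \<Rightarrow> 'r) \<Rightarrow> int \<Rightarrow> 'r" where
  "Q_op \<kappa> \<alpha> h x = h (x - 1) - \<kappa> (\<alpha> + inverse \<alpha>) * h x + h (x + 1)"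

text \<open>
  The derivation of degree \<open>1\<close> which vanishes on the even generators and maps the odd generator at
  \<open>x\<close> to \<open>lin (Q_op \<kappa> \<alpha> (delta x))\<close>.
\<close>

definition d_classical ::
  "('k::field_char_0 \<Rightarrow> 'r::comm_ring_1) \<Rightarrow> 'k \<Rightarrow> real \<Rightarrow> real \<Rightarrow> 'r sym \<Rightarrow> 'r sym" where
  "d_classical \<kappa> \<alpha> a b f =
     (\<Sum>x \<in> sites (a + 1) (b - 1). lin (Q_op \<kappa> \<alpha> (delta x)) \<cdot>\<^sub>s odd_partial x f)"

definition BV_laplacian :: "real \<Rightarrow> real \<Rightarrow> 'r::comm_ring_1 sym \<Rightarrow> 'r sym" where
  "BV_laplacian a b f = (\<Sum>x \<in> sites (a + 1) (b - 1). odd_partial x (even_partial x f))"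

definition d_quantum ::
  "('k::field_char_0 \<Rightarrow> 'r::comm_ring_1) \<Rightarrow> 'r \<Rightarrow> 'k \<Rightarrow> real \<Rightarrow> real \<Rightarrow> 'r sym \<Rightarrow> 'r sym" where
  "d_quantum \<kappa> hbar \<alpha> a b f = d_classical \<kappa> \<alpha> a b f + scalar hbar \<cdot>\<^sub>s BV_laplacian a b f"

definition cocycles0 ::
  "('k::field_char_0 \<Rightarrow> 'r::comm_ring_1) \<Rightarrow> 'r \<Rightarrow> 'k \<Rightarrow> real \<Rightarrow> real \<Rightarrow> 'r sym set" where
  "cocycles0 \<kappa> hbar \<alpha> a b = {f \<in> Sym_deg a b 0. d_quantum \<kappa> hbar \<alpha> a b f = 0}"

definition coboundaries0 ::
  "('k::field_char_0 \<Rightarrow> 'r::comm_ring_1) \<Rightarrow> 'r \<Rightarrow> 'k \<Rightarrow> real \<Rightarrow> real \<Rightarrow> 'r sym set" where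
  "coboundaries0 \<kappa> hbar \<alpha> a b = d_quantum \<kappa> hbar \<alpha> a b ` Sym_deg a b (- 1)"

definition coh_class ::
  "('k::field_char_0 \<Rightarrow> 'r::comm_ring_1) \<Rightarrow> 'r \<Rightarrow> 'k \<Rightarrow> real \<Rightarrow> real \<Rightarrow> 'r sym \<Rightarrow> 'r sym set" where
  "coh_class \<kappa> hbar \<alpha> a b f = (\<lambda>u. f + u) ` coboundaries0 \<kappa> hbar \<alpha> a b"

definition H0 ::
  "('k::field_char_0 \<Rightarrow> 'r::comm_ring_1) \<Rightarrow> 'r \<Rightarrow> 'k \<Rightarrow> real \<Rightarrow> real \<Rightarrow> 'r sym set set" where
  "H0 \<kappa> hbar \<alpha> a b = coh_class \<kappa> hbar \<alpha> a b ` cocycles0 \<kappa> hbar \<alpha> a b"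

text \<open>
  Maps induced on classes by (bi)linear operations on representatives; the target is the interval
  \<open>(a, b)\<close>. The union is over equal cosets whenever the operation descends to classes, as in the
  library's construction of factor rings.
\<close>

definition induced ::
  "('k::field_char_0 \<Rightarrow> 'r::comm_ring_1) \<Rightarrow> 'r \<Rightarrow> 'k \<Rightarrow> real \<Rightarrow> real \<Rightarrow>
   ('r sym \<Rightarrow> 'r sym) \<Rightarrow> 'r sym set \<Rightarrow> 'r sym set" where
  "induced \<kappa> hbar \<alpha> a b F U = (\<Union>f\<in>U. coh_class \<kappa> hbar \<alpha> a b (F f))"

definition induced2 ::
  "('k::field_char_0 \<Rightarrow> 'r::comm_ring_1) \<Rightarrow> 'r \<Rightarrow> 'k \<Rightarrow> real \<Rightarrow> real \<Rightarrow>
   ('r sym \<Rightarrow> 'r sym \<Rightarrow> 'r sym) \<Rightarrow> 'r sym set \<Rightarrow> 'r sym set \<Rightarrow> 'r sym set" where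
  "induced2 \<kappa> hbar \<alpha> a b F U V = (\<Union>f\<in>U. \<Union>g\<in>V. coh_class \<kappa> hbar \<alpha> a b (F f g))"

text \<open>The map induced by inclusion of an interval into \<open>(a, b)\<close>.\<close>

definition incl ::
  "('k::field_char_0 \<Rightarrow> 'r::comm_ring_1) \<Rightarrow> 'r \<Rightarrow> 'k \<Rightarrow> real \<Rightarrow> real \<Rightarrow>
   'r sym set \<Rightarrow> 'r sym set" where
  "incl \<kappa> hbar \<alpha> a b = induced \<kappa> hbar \<alpha> a b (\<lambda>f. f)"

text \<open>
  The product on the cohomology of \<open>J = (-4, 4)\<close> obtained from subintervals \<open>(a1, b1)\<close>, \<open>(a2, b2)\<close>.
\<close>

definition star ::
  "('k::field_char_0 \<Rightarrow> 'r::comm_ring_1) \<Rightarrow> 'r \<Rightarrow> 'k \<Rightarrow> real \<Rightarrow> real \<Rightarrow> real \<Rightarrow> real \<Rightarrow>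
   'r sym set \<Rightarrow> 'r sym set \<Rightarrow> 'r sym set" where
  "star \<kappa> hbar \<alpha> a1 b1 a2 b2 U V =
     induced2 \<kappa> hbar \<alpha> (- 4) 4 (\<cdot>\<^sub>s)
       (inv_into (H0 \<kappa> hbar \<alpha> a1 b1) (incl \<kappa> hbar \<alpha> (- 4) 4) U)
       (inv_into (H0 \<kappa> hbar \<alpha> a2 b2) (incl \<kappa> hbar \<alpha> (- 4) 4) V)"

definition obs_algebra ::
  "('k::field_char_0 \<Rightarrow> 'r::comm_ring_1) \<Rightarrow> 'r \<Rightarrow> 'k \<Rightarrow> real \<Rightarrow> real \<Rightarrow> real \<Rightarrow> real \<Rightarrow>
   ('r, 'r sym set) module" where
  "obs_algebra \<kappa> hbar \<alpha> a1 b1 a2 b2 =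
     \<lparr>carrier = H0 \<kappa> hbar \<alpha> (- 4) 4,
      monoid.mult = star \<kappa> hbar \<alpha> a1 b1 a2 b2,
      one = coh_class \<kappa> hbar \<alpha> (- 4) 4 (scalar 1),
      zero = coh_class \<kappa> hbar \<alpha> (- 4) 4 0,
      add = induced2 \<kappa> hbar \<alpha> (- 4) 4 (+),
      module.smult = (\<lambda>c. induced \<kappa> hbar \<alpha> (- 4) 4 (\<lambda>f. scalar c \<cdot>\<^sub>s f))\<rparr>"


section \<open>Translation\<close>

definition shift_mon :: "int \<Rightarrow> (int \<Rightarrow>\<^sub>0 nat) \<Rightarrow> (int \<Rightarrow>\<^sub>0 nat)" where
  "shift_mon n m = (\<Sum>x \<in> Poly_Mapping.keys m.
     Poly_Mapping.single (x + n) (Poly_Mapping.lookup m x))"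

definition shift_pol :: "int \<Rightarrow> 'r::comm_ring_1 pol \<Rightarrow> 'r pol" where
  "shift_pol n P = (\<Sum>m \<in> Poly_Mapping.keys P.
     Poly_Mapping.single (shift_mon n m) (Poly_Mapping.lookup P m))"

text \<open>
  The algebra automorphism replacing the generators at \<open>x\<close> by those at \<open>x + n\<close>. There is no sign,
  since a translation preserves the order of the odd generators.
\<close>

definition shift :: "int \<Rightarrow> 'r::comm_ring_1 sym \<Rightarrow> 'r sym" where
  "shift n f = (\<Sum>S \<in> Poly_Mapping.keys f.
     Poly_Mapping.single ((\<lambda>x. x + n) |`| S) (shift_pol n (Poly_Mapping.lookup f S)))"

text \<open>
  The action of \<open>1\<close> on the cohomology of \<open>J = (-4, 4)\<close>: translation to \<open>J + 1 = (-3, 5)\<close>,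
  inclusion into \<open>J' = (a', b')\<close>, and the inverse of the inclusion of \<open>J\<close> into \<open>J'\<close>.
\<close>

definition translation ::
  "('k::field_char_0 \<Rightarrow> 'r::comm_ring_1) \<Rightarrow> 'r \<Rightarrow> 'k \<Rightarrow> real \<Rightarrow> real \<Rightarrow>
   'r sym set \<Rightarrow> 'r sym set" where
  "translation \<kappa> hbar \<alpha> a' b' U =
     inv_into (H0 \<kappa> hbar \<alpha> (- 4) 4) (incl \<kappa> hbar \<alpha> a' b')
       (incl \<kappa> hbar \<alpha> a' b' (induced \<kappa> hbar \<alpha> (- 3) 5 (shift 1) U))"


section \<open>The Weyl algebra\<close>

datatype weyl_gen = Gen_q | Gen_p

text \<open>
  Words in the two generators, with concatenation written additively, so that the free associative
  algebra is the monoid algebra \<open>word \<Rightarrow>\<^sub>0 'r\<close> with the convolution product of the library.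
\<close>

datatype word = Word (letters: "weyl_gen list")

instantiation word :: monoid_add
begin

definition zero_word :: word where "0 = Word []"

definition plus_word :: "word \<Rightarrow> word \<Rightarrow> word" where "u + v = Word (letters u @ letters v)"

instance
  by standard (auto simp: zero_word_def plus_word_def)

end

type_synonym 'r free_alg = "word \<Rightarrow>\<^sub>0 'r"

definition free_q :: "'r::comm_ring_1 free_alg" where
  "free_q = Poly_Mapping.single (Word [Gen_q]) 1"

definition free_p :: "'r::comm_ring_1 free_alg" where
  "free_p = Poly_Mapping.single (Word [Gen_p]) 1"

definition weyl_ideal :: "'r::comm_ring_1 \<Rightarrow> 'r free_alg set" where
  "weyl_ideal hbar = genideal ring_of_type_algebra
     {free_p * free_q - free_q * free_p - Poly_Mapping.single 0 hbar}"

definition weyl_class :: "'r::comm_ring_1 \<Rightarrow> 'r free_alg \<Rightarrow> 'r free_alg set" where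
  "weyl_class hbar w = weyl_ideal hbar +>\<^bsub>ring_of_type_algebra\<^esub> w"

definition weyl_algebra :: "'r::comm_ring_1 \<Rightarrow> ('r, 'r free_alg set) module" where
  "weyl_algebra hbar = ring.extend (ring_of_type_algebra Quot weyl_ideal hbar)
     \<lparr>module.smult = (\<lambda>c U. \<Union>w\<in>U. weyl_class hbar (Poly_Mapping.single 0 c * w))\<rparr>"

definition weyl_q :: "'r::comm_ring_1 \<Rightarrow> 'r free_alg set" where
  "weyl_q hbar = weyl_class hbar free_q"

definition weyl_p :: "'r::comm_ring_1 \<Rightarrow> 'r free_alg set" where
  "weyl_p hbar = weyl_class hbar free_p"

definition algebra_iso ::
  "('r, 'a) module \<Rightarrow> ('r, 'b) module \<Rightarrow> ('a \<Rightarrow> 'b) set" where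
  "algebra_iso M N = {h \<in> ring_iso M N.
     \<forall>c. \<forall>x \<in> carrier M. h (c \<odot>\<^bsub>M\<^esub> x) = c \<odot>\<^bsub>N\<^esub> h x}"

text \<open>
  \<open>\<phi>\<close> is the identification of the Weyl algebra with the observables; it is determined on the
  carrier by its values on the generators.
\<close>

definition weyl_identification ::
  "('k::field_char_0 \<Rightarrow> 'r::comm_ring_1) \<Rightarrow> 'r \<Rightarrow> 'k \<Rightarrow> real \<Rightarrow> real \<Rightarrow> real \<Rightarrow> real \<Rightarrow>
   ('r free_alg set \<Rightarrow> 'r sym set) \<Rightarrow> bool" where
  "weyl_identification \<kappa> hbar \<alpha> a1 b1 a2 b2 \<phi> \<longleftrightarrow>
     \<phi> \<in> algebra_iso (weyl_algebra hbar) (obs_algebra \<kappa> hbar \<alpha> a1 b1 a2 b2) \<and>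
     \<phi> (weyl_q hbar) = coh_class \<kappa> hbar \<alpha> (- 4) 4 (lin (delta 0)) \<and>
     \<phi> (weyl_p hbar) = coh_class \<kappa> hbar \<alpha> (- 4) 4
       (scalar (\<kappa> (1 / 2)) \<cdot>\<^sub>s (lin (delta 1) - lin (delta (- 1))))"

definition weyl_translation ::
  "('k::field_char_0 \<Rightarrow> 'r::comm_ring_1) \<Rightarrow> 'r \<Rightarrow> 'k \<Rightarrow> real \<Rightarrow> real \<Rightarrow>
   ('r free_alg set \<Rightarrow> 'r sym set) \<Rightarrow> 'r free_alg set \<Rightarrow> 'r free_alg set" where
  "weyl_translation \<kappa> hbar \<alpha> a' b' \<phi> w =
     inv_into (carrier (weyl_algebra hbar)) \<phi> (translation \<kappa> hbar \<alpha> a' b' (\<phi> w))"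

end

(* A polynomial in the generators delta_x is sent to the product, from left to right
in increasing order of sites, of the elements hat x of the Weyl algebra; here hat is the solution of
h (x - 1) - (alpha + 1/alpha) h x + h (x + 1) = 0 with hat 0 = q and hat 1 - hat (-1) = 2 p. Since
hat (x + 1) and hat x have commutator hbar at every x, the quantum correction hbar * Delta is exactly
the reordering error, so this map kills coboundaries. It turns products of left and right factors into
products in the Weyl algebra, and it is bijective on H^0 of every interval with two sites l, l + 1: the
equation of motion reduces every class to a polynomial in these two generators, and a representation
of the Weyl algebra on such polynomials recovers the polynomial from its image. Translation by 1
becomes the substitution hat x -> hat (x + 1), whose matrix in q, p is read off from the recurrence. *)
theory Submission
  imports Defs
begin

section \<open>Linear maps between monoid algebras\<close>

text \<open>The statement involves inverses of inclusions picked by \<open>inv_into\<close> and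
  claims that an identification exists, so the bijectivity of inclusions on \<open>H0\<close> and
  the size of \<open>H0\<close> have to be proved. Both follow because the formula for the
  time-ordered map does not mention the interval: over every interval of length greater than 2 a
  class consists of all polynomials on its sites with a given value modulo the Weyl relation. In
  this description inclusions and their inverses leave the value unchanged. The obstacle is that a
  generated ideal gives no direct way to show that an element lies outside it. The representation
  provides one: it kills the ideal, yet still separates polynomials in two neighbouring generators.
  The calculations run over a commutative ring with a parameter \<open>g\<close> for (\<alpha> +
  1/\<alpha>)/2. The matrix of one step, with rows (g, 1) and (g^2 - 1, g), has determinant 1. Hence
  any two neighbouring hats span the same module as q and p, without division, and their commutator
  is the same at every site.\<close>

abbreviation const :: "'r::comm_ring_1 \<Rightarrow> 'm::monoid_add \<Rightarrow>\<^sub>0 'r" where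
  "const \<equiv> Poly_Mapping.single 0"

lemma const_mult_single:
  "const c * Poly_Mapping.single m d = Poly_Mapping.single (m :: 'm::monoid_add) (c * d :: 'r::comm_ring_1)"
  by (simp add: mult_single)

lemma poly_mapping_eq_sum_single:
  "P = (\<Sum>m\<in>Poly_Mapping.keys P. Poly_Mapping.single m (Poly_Mapping.lookup P m :: 'r::comm_ring_1))"
proof (rule poly_mapping_eqI)
  fix k
  show "Poly_Mapping.lookup P k =
    Poly_Mapping.lookup (\<Sum>m\<in>Poly_Mapping.keys P. Poly_Mapping.single m (Poly_Mapping.lookup P m)) k"
    by (simp add: lookup_sum lookup_single when_def sum.delta in_keys_iff)
qed

text \<open>With \<open>A\<close> the monomials on a set of sites this gives induction inside the
  algebra of an interval; with \<open>UNIV\<close> it extends a claim from terms to sums.\<close>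

lemma poly_mapping_span_induct [consumes 1, case_names zero add single]:
  fixes P :: "'m \<Rightarrow>\<^sub>0 'r::comm_ring_1"
  assumes "Poly_Mapping.keys P \<subseteq> A"
    and "\<Phi> 0" and "\<And>P Q. \<Phi> P \<Longrightarrow> \<Phi> Q \<Longrightarrow> \<Phi> (P + Q)"
    and "\<And>m c. m \<in> A \<Longrightarrow> \<Phi> (Poly_Mapping.single m c)"
  shows "\<Phi> P"
proof -
  have "\<Phi> (\<Sum>m\<in>B. Poly_Mapping.single m (Poly_Mapping.lookup P m))" if "finite B" "B \<subseteq> A" for B
    using that by (induction B) (auto intro: assms)
  from this[of "Poly_Mapping.keys P"] show ?thesis
    using assms(1) poly_mapping_eq_sum_single[of P] by simp
qed

text \<open>Scalars sit at the neutral element of the monoid, so they are central even in the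
  noncommutative algebra of words.\<close>

lemma const_mult_commute:
  fixes P :: "'m::monoid_add \<Rightarrow>\<^sub>0 'r::comm_ring_1"
  shows "const c * P = P * const c"
proof -
  have "Poly_Mapping.keys P \<subseteq> UNIV" by simp
  then show ?thesis
    by (induction rule: poly_mapping_span_induct) (auto simp: mult_single algebra_simps)
qed

text \<open>Scalar multiplication is expressed as multiplication by \<open>const c\<close>, which
  treats commutative polynomials and words alike.\<close>

definition linear_pm :: "(('m::monoid_add \<Rightarrow>\<^sub>0 'r) \<Rightarrow> ('n::monoid_add \<Rightarrow>\<^sub>0 'r::comm_ring_1)) \<Rightarrow> bool" where
  "linear_pm L \<longleftrightarrow> (\<forall>P Q. L (P + Q) = L P + L Q) \<and> (\<forall>c P. L (const c * P) = const c * L P)"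

lemma linear_pmI:
  "(\<And>P Q. L (P + Q) = L P + L Q) \<Longrightarrow> (\<And>c P. L (const c * P) = const c * L P) \<Longrightarrow> linear_pm L"
  by (simp add: linear_pm_def)

lemma linear_pm_add: "linear_pm L \<Longrightarrow> L (P + Q) = L P + L Q"
  by (simp add: linear_pm_def)

lemma linear_pm_scale: "linear_pm L \<Longrightarrow> L (const c * P) = const c * L P"
  by (simp add: linear_pm_def)

lemma linear_pm_zero: "linear_pm L \<Longrightarrow> L 0 = 0"
  using linear_pm_add[of L 0 0] by simp

lemma linear_pm_minus: "linear_pm L \<Longrightarrow> L (P - Q) = L P - L Q"
  using linear_pm_add[of L "P - Q" Q] by simp

lemma linear_pm_single: "linear_pm L \<Longrightarrow> L (Poly_Mapping.single m c) = const c * L (Poly_Mapping.single m 1)"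
  using linear_pm_scale[of L c "Poly_Mapping.single m 1"] by (simp add: const_mult_single)

lemma linear_pm_eq_on:
  assumes "linear_pm L" "linear_pm L'" "Poly_Mapping.keys P \<subseteq> A"
    and "\<And>m. m \<in> A \<Longrightarrow> L (Poly_Mapping.single m 1) = L' (Poly_Mapping.single m 1)"
  shows "L P = L' P"
  using assms(3)
proof (induction rule: poly_mapping_span_induct)
  case (single m c)
  then show ?case
    using assms(4) linear_pm_single[OF assms(1), of m c] linear_pm_single[OF assms(2), of m c] by simp
qed (use assms(1,2) in \<open>simp_all add: linear_pm_zero linear_pm_add\<close>)

lemma linear_pm_eqI:
  assumes "linear_pm L" "linear_pm L'"
    and "\<And>m. L (Poly_Mapping.single m 1) = L' (Poly_Mapping.single m 1)"
  shows "L P = L' P"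
  using linear_pm_eq_on[OF assms(1,2), of P UNIV] assms(3) by simp

lemma linear_pm_id [intro]: "linear_pm (\<lambda>P. P)"
  by (rule linear_pmI) auto

lemma linear_pm_comp [intro]: "linear_pm L \<Longrightarrow> linear_pm L' \<Longrightarrow> linear_pm (\<lambda>P. L (L' P))"
  by (simp add: linear_pm_def)

lemma linear_pm_plus [intro]: "linear_pm L \<Longrightarrow> linear_pm L' \<Longrightarrow> linear_pm (\<lambda>P. L P + L' P)"
  by (auto simp: linear_pm_def algebra_simps)

lemma linear_pm_diff [intro]: "linear_pm L \<Longrightarrow> linear_pm L' \<Longrightarrow> linear_pm (\<lambda>P. L P - L' P)"
  by (auto simp: linear_pm_def algebra_simps)

lemma linear_pm_mult_left [intro]: "linear_pm L \<Longrightarrow> linear_pm (\<lambda>P. w * L P)"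
  unfolding linear_pm_def
  by (metis const_mult_commute distrib_left mult.assoc)

lemma linear_pm_mult_right [intro]: "linear_pm L \<Longrightarrow> linear_pm (\<lambda>P. L P * w)"
  by (simp add: linear_pm_def algebra_simps)

definition lin_ext :: "('m \<Rightarrow> ('n::monoid_add \<Rightarrow>\<^sub>0 'r::comm_ring_1)) \<Rightarrow> ('m \<Rightarrow>\<^sub>0 'r) \<Rightarrow> ('n \<Rightarrow>\<^sub>0 'r)" where
  "lin_ext t P = (\<Sum>m\<in>Poly_Mapping.keys P. const (Poly_Mapping.lookup P m) * t m)"

lemma lin_ext_superset:
  assumes "finite A" "Poly_Mapping.keys P \<subseteq> A"
  shows "lin_ext t P = (\<Sum>m\<in>A. const (Poly_Mapping.lookup P m) * t m)"
  unfolding lin_ext_def using assms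
  by (intro sum.mono_neutral_left) (auto simp: in_keys_iff)

lemma lin_ext_single: "lin_ext t (Poly_Mapping.single m c) = const c * t m"
  by (simp add: lin_ext_def)

lemma linear_pm_lin_ext [intro]: "linear_pm (lin_ext t)"
proof (rule linear_pmI)
  fix P Q :: "'a \<Rightarrow>\<^sub>0 'b"
  let ?A = "Poly_Mapping.keys P \<union> Poly_Mapping.keys Q"
  show "lin_ext t (P + Q) = lin_ext t P + lin_ext t Q"
    using lin_ext_superset[of ?A P t] lin_ext_superset[of ?A Q t]
      lin_ext_superset[of ?A "P + Q" t] keys_add[of P Q]
    by (simp add: lookup_add single_add distrib_right sum.distrib)
next
  fix c and P :: "'a \<Rightarrow>\<^sub>0 'b"
  have l: "Poly_Mapping.lookup (const c * P) m = c * Poly_Mapping.lookup P m" for m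
  proof -
    have "Poly_Mapping.keys P \<subseteq> UNIV" by simp
    then show ?thesis
      by (induction rule: poly_mapping_span_induct)
        (auto simp: const_mult_single lookup_add lookup_single when_def algebra_simps)
  qed
  have "lin_ext t (const c * P) =
      (\<Sum>m\<in>Poly_Mapping.keys P. const (Poly_Mapping.lookup (const c * P) m) * t m)"
    by (rule lin_ext_superset) (auto simp: l in_keys_iff)
  also have "\<dots> = const c * lin_ext t P"
    by (simp add: l lin_ext_def sum_distrib_left mult.assoc[symmetric] mult_single)
  finally show "lin_ext t (const c * P) = const c * lin_ext t P" .
qed


section \<open>The Weyl ideal\<close>

lemma ring_of_type_algebra_sel [simp]:
  "carrier (ring_of_type_algebra :: 'a::ring_1 ring) = UNIV"
  "monoid.mult (ring_of_type_algebra :: 'a ring) = (*)"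
  "one (ring_of_type_algebra :: 'a ring) = 1"
  "zero (ring_of_type_algebra :: 'a ring) = 0"
  "add (ring_of_type_algebra :: 'a ring) = (+)"
  by (simp_all add: ring_of_type_algebra_def)

lemma ring_ring_of_type_algebra: "ring (ring_of_type_algebra :: 'a::ring_1 ring)"
proof -
  have "\<exists>y. x + y = 0" for x :: 'a
    using add.right_inverse by blast
  then show ?thesis
    unfolding ring_of_type_algebra_def using add.right_inverse
    by unfold_locales (auto simp: algebra_simps Units_def)
qed

lemma ideal_ring_of_type_algebraI:
  fixes J :: "'a::ring_1 set"
  assumes "0 \<in> J" "\<And>a b. a \<in> J \<Longrightarrow> b \<in> J \<Longrightarrow> a + b \<in> J"
    and "\<And>w a. a \<in> J \<Longrightarrow> w * a \<in> J" "\<And>w a. a \<in> J \<Longrightarrow> a * w \<in> J"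
  shows "ideal J ring_of_type_algebra"
proof (rule idealI)
  show "ring (ring_of_type_algebra :: 'a ring)" by (rule ring_ring_of_type_algebra)
  then interpret ring "ring_of_type_algebra :: 'a ring" .
  have neg: "- a \<in> J" if "a \<in> J" for a using assms(3)[OF that, of "- 1"] by simp
  have inv: "\<ominus>\<^bsub>ring_of_type_algebra\<^esub> a = - a" for a :: 'a
    by (rule minus_equality) simp_all
  show "subgroup J (add_monoid ring_of_type_algebra)"
    using assms neg inv by (intro subgroup.intro) (auto simp: a_inv_def)
qed (use assms in simp_all)

lemma ideal_weyl_ideal: "ideal (weyl_ideal hbar) ring_of_type_algebra"
  unfolding weyl_ideal_def by (rule ring.genideal_ideal[OF ring_ring_of_type_algebra]) simp

lemma weyl_ideal_rel: "free_p * free_q - free_q * free_p - const hbar \<in> weyl_ideal hbar"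
  unfolding weyl_ideal_def by (rule ring.genideal_self'[OF ring_ring_of_type_algebra]) simp

text \<open>The device for proving something about every element of the ideal: \<open>J\<close> will
  be the preimage of the ideal under a substitution, or the annihilator of a representation.\<close>

lemma weyl_ideal_minimal:
  assumes "0 \<in> J" "\<And>a b. a \<in> J \<Longrightarrow> b \<in> J \<Longrightarrow> a + b \<in> J"
    and "\<And>w a. a \<in> J \<Longrightarrow> w * a \<in> J" "\<And>w a. a \<in> J \<Longrightarrow> a * w \<in> J"
    and "free_p * free_q - free_q * free_p - const hbar \<in> J"
  shows "weyl_ideal hbar \<subseteq> J"
  unfolding weyl_ideal_def
  by (rule ring.genideal_minimal[OF ring_ring_of_type_algebra ideal_ring_of_type_algebraI])
    (use assms in auto)

lemma weyl_ideal_zero: "0 \<in> weyl_ideal hbar"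
  using additive_subgroup.zero_closed[OF ideal.axioms(1)[OF ideal_weyl_ideal]] by simp

lemma weyl_ideal_add: "a \<in> weyl_ideal hbar \<Longrightarrow> b \<in> weyl_ideal hbar \<Longrightarrow> a + b \<in> weyl_ideal hbar"
  using additive_subgroup.a_closed[OF ideal.axioms(1)[OF ideal_weyl_ideal], of a hbar b] by simp

lemma weyl_ideal_mult_left: "a \<in> weyl_ideal hbar \<Longrightarrow> w * a \<in> weyl_ideal hbar"
  using ideal.I_l_closed[OF ideal_weyl_ideal, of a hbar w] by simp

lemma weyl_ideal_mult_right: "a \<in> weyl_ideal hbar \<Longrightarrow> a * w \<in> weyl_ideal hbar"
  using ideal.I_r_closed[OF ideal_weyl_ideal, of a hbar w] by simp

lemma weyl_ideal_uminus: "a \<in> weyl_ideal hbar \<Longrightarrow> - a \<in> weyl_ideal hbar"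
  using weyl_ideal_mult_left[of a hbar "- 1"] by simp

text \<open>Calculations in the Weyl algebra use representatives in the free algebra modulo this
  relation, rather than cosets.\<close>

definition weyl_cong :: "'r::comm_ring_1 \<Rightarrow> 'r free_alg \<Rightarrow> 'r free_alg \<Rightarrow> bool" where
  "weyl_cong hbar a b \<longleftrightarrow> a - b \<in> weyl_ideal hbar"

lemma weyl_cong_refl [simp]: "weyl_cong hbar a a"
  by (simp add: weyl_cong_def weyl_ideal_zero)

lemma weyl_cong_sym: "weyl_cong hbar a b \<Longrightarrow> weyl_cong hbar b a"
  using weyl_ideal_uminus[of "a - b" hbar] by (simp add: weyl_cong_def)

lemma weyl_cong_trans [trans]: "weyl_cong hbar a b \<Longrightarrow> weyl_cong hbar b c \<Longrightarrow> weyl_cong hbar a c"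
  using weyl_ideal_add[of "a - b" hbar "b - c"] by (simp add: weyl_cong_def)

lemma weyl_cong_add: "weyl_cong hbar a b \<Longrightarrow> weyl_cong hbar c d \<Longrightarrow> weyl_cong hbar (a + c) (b + d)"
  using weyl_ideal_add[of "a - b" hbar "c - d"] by (simp add: weyl_cong_def algebra_simps)

lemma weyl_cong_diff: "weyl_cong hbar a b \<Longrightarrow> weyl_cong hbar c d \<Longrightarrow> weyl_cong hbar (a - c) (b - d)"
  using weyl_ideal_add[of "a - b" hbar "- (c - d)"] weyl_ideal_uminus[of "c - d" hbar]
  by (simp add: weyl_cong_def algebra_simps)

lemma weyl_cong_mult_left: "weyl_cong hbar a b \<Longrightarrow> weyl_cong hbar (w * a) (w * b)"
  using weyl_ideal_mult_left[of "a - b" hbar w] by (simp add: weyl_cong_def algebra_simps)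

lemma weyl_cong_mult_right: "weyl_cong hbar a b \<Longrightarrow> weyl_cong hbar (a * w) (b * w)"
  using weyl_ideal_mult_right[of "a - b" hbar w] by (simp add: weyl_cong_def algebra_simps)

lemma weyl_cong_mult: "weyl_cong hbar a b \<Longrightarrow> weyl_cong hbar c d \<Longrightarrow> weyl_cong hbar (a * c) (b * d)"
  using weyl_cong_mult_left weyl_cong_mult_right weyl_cong_trans by metis


section \<open>Actions of the free algebra\<close>

text \<open>One construction for two purposes: left multiplications as operators yield
  substitutions, and the operators \<open>weyl_op\<close> yield the representation on
  polynomials.\<close>

definition free_act ::
  "(weyl_gen \<Rightarrow> ('n::monoid_add \<Rightarrow>\<^sub>0 'r::comm_ring_1) \<Rightarrow> ('n \<Rightarrow>\<^sub>0 'r)) \<Rightarrow> 'r free_alg \<Rightarrow> ('n \<Rightarrow>\<^sub>0 'r) \<Rightarrow> ('n \<Rightarrow>\<^sub>0 'r)"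
  where "free_act A w f = lin_ext (\<lambda>u. foldr A (letters u) f) w"

lemma free_act_single: "free_act A (Poly_Mapping.single u c) f = const c * foldr A (letters u) f"
  by (simp add: free_act_def lin_ext_single)

lemma free_act_const: "free_act A (const c) f = const c * f"
  by (simp add: free_act_single zero_word_def)

lemma free_act_1 [simp]: "free_act A 1 f = f"
  using free_act_const[of A 1 f] by simp

lemma free_act_gen [simp]: "free_act A free_q f = A Gen_q f" "free_act A free_p f = A Gen_p f"
  by (simp_all add: free_q_def free_p_def free_act_single)

lemma linear_pm_free_act1: "linear_pm (\<lambda>w. free_act A w f)"
  unfolding free_act_def by (rule linear_pm_lin_ext)

lemma linear_pm_free_act:
  assumes "\<And>x. linear_pm (A x)"
  shows "linear_pm (free_act A w)"
proof -
  have *: "linear_pm (foldr A xs)" for xs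
    by (induction xs) (use assms in \<open>auto simp: linear_pm_def\<close>)
  have "Poly_Mapping.keys w \<subseteq> UNIV" by simp
  then show ?thesis
  proof (induction rule: poly_mapping_span_induct)
    case zero
    show ?case by (simp add: linear_pm_def free_act_def lin_ext_def)
  next
    case (add P Q)
    then show ?case
      by (simp add: linear_pm_def linear_pm_add[OF linear_pm_free_act1] algebra_simps)
  next
    case (single m c)
    show ?case
      using linear_pm_mult_left[OF *] by (simp add: free_act_single[abs_def] del: foldr.simps)
  qed
qed

lemma free_act_mult:
  assumes "\<And>x. linear_pm (A x)"
  shows "free_act A (v * w) f = free_act A v (free_act A w f)"
proof (rule linear_pm_eqI[of "\<lambda>v. free_act A (v * w) f" "\<lambda>v. free_act A v (free_act A w f)"])
  show "linear_pm (\<lambda>v. free_act A (v * w) f)"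
    by (rule linear_pm_comp[OF linear_pm_free_act1 linear_pm_mult_right[OF linear_pm_id]])
  show "linear_pm (\<lambda>v. free_act A v (free_act A w f))"
    by (rule linear_pm_free_act1)
  fix u
  let ?u = "Poly_Mapping.single u 1 :: 'b free_alg"
  show "free_act A (?u * w) f = free_act A ?u (free_act A w f)"
  proof (rule linear_pm_eqI[of "\<lambda>w. free_act A (?u * w) f" "\<lambda>w. free_act A ?u (free_act A w f)"])
    show "linear_pm (\<lambda>w. free_act A (?u * w) f)"
      by (rule linear_pm_comp[OF linear_pm_free_act1 linear_pm_mult_left[OF linear_pm_id]])
    show "linear_pm (\<lambda>w. free_act A ?u (free_act A w f))"
      by (rule linear_pm_comp[OF linear_pm_free_act[OF assms] linear_pm_free_act1])
  qed (simp add: mult_single free_act_single plus_word_def)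
qed

text \<open>Letters are added on the left because a word acts by its first letter last; each step
  then concerns one operator applied to a known result.\<close>

lemma free_alg_induct [case_names const q p add]:
  assumes "\<And>c. \<Phi> (const c)" "\<And>w. \<Phi> w \<Longrightarrow> \<Phi> (free_q * w)" "\<And>w. \<Phi> w \<Longrightarrow> \<Phi> (free_p * w)"
    and "\<And>v w. \<Phi> v \<Longrightarrow> \<Phi> w \<Longrightarrow> \<Phi> (v + w)"
  shows "\<Phi> w"
proof -
  have *: "\<Phi> (Poly_Mapping.single (Word xs) c)" for xs c
  proof (induction xs)
    case Nil
    show ?case using assms(1)[of c] by (simp add: zero_word_def)
  next
    case (Cons x xs)
    have "Poly_Mapping.single (Word (x # xs)) c =
        (if x = Gen_q then free_q else free_p) * Poly_Mapping.single (Word xs) c"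
      by (cases x) (simp_all add: free_q_def free_p_def mult_single plus_word_def)
    then show ?case using assms(2,3) Cons.IH by (cases x) auto
  qed
  have "Poly_Mapping.keys w \<subseteq> UNIV" by simp
  then show ?thesis
  proof (induction rule: poly_mapping_span_induct)
    case zero
    show ?case using assms(1)[of 0] by simp
  next
    case (single m c)
    then show ?case using * by (cases m) simp
  qed (rule assms(4))
qed

definition free_subst :: "(weyl_gen \<Rightarrow> 'r free_alg) \<Rightarrow> 'r::comm_ring_1 free_alg \<Rightarrow> 'r free_alg" where
  "free_subst s w = free_act (\<lambda>x f. s x * f) w 1"

lemma free_subst_simps [simp]:
  "free_subst s free_q = s Gen_q" "free_subst s free_p = s Gen_p"
  "free_subst s (const c) = const c" "free_subst s 1 = 1"
  by (simp_all add: free_subst_def free_act_const)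

lemma linear_pm_free_subst: "linear_pm (free_subst s)"
  unfolding free_subst_def by (rule linear_pm_free_act1)

lemma free_subst_mult [simp]: "free_subst s (v * w) = free_subst s v * free_subst s w"
proof -
  have lin: "linear_pm (\<lambda>f. s x * f)" for x
    by (rule linear_pm_mult_left[OF linear_pm_id])
  \<comment> \<open>Left and right multiplications commute, so the action on \<open>f\<close> is
    determined by the action on 1.\<close>
  have "free_act (\<lambda>x f. s x * f) v f = free_act (\<lambda>x f. s x * f) v 1 * f" for f
  proof (induction v rule: free_alg_induct)
    case (add v w)
    then show ?case by (simp add: linear_pm_add[OF linear_pm_free_act1] algebra_simps)
  qed (auto simp: free_act_const free_act_mult[OF lin] mult.assoc)
  from this[of "free_act (\<lambda>x f. s x * f) w 1"] show ?thesis
    unfolding free_subst_def by (simp only: free_act_mult[OF lin])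
qed

lemma free_subst_add [simp]: "free_subst s (v + w) = free_subst s v + free_subst s w"
  by (rule linear_pm_add[OF linear_pm_free_subst])

lemma free_subst_diff [simp]: "free_subst s (v - w) = free_subst s v - free_subst s w"
  by (rule linear_pm_minus[OF linear_pm_free_subst])

lemma free_subst_id:
  assumes "s Gen_q = free_q" "s Gen_p = free_p"
  shows "free_subst s w = w"
  by (induction w rule: free_alg_induct) (simp_all add: assms)

lemma free_subst_comp:
  "free_subst s (free_subst s' w) = free_subst (\<lambda>x. free_subst s (s' x)) w"
  by (induction w rule: free_alg_induct) simp_all

lemma free_subst_power [simp]: "free_subst s (w ^ n) = free_subst s w ^ n"
  by (induction n) simp_all


section \<open>The generators as elements of the Weyl algebra\<close>

abbreviation lin_qp :: "'r::comm_ring_1 \<Rightarrow> 'r \<Rightarrow> 'r free_alg" where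
  "lin_qp s t \<equiv> const s * free_q + const t * free_p"

text \<open>The commutator is bilinear and alternating, so only the determinant of the coefficients
  survives.\<close>

lemma lin_qp_commutator:
  "lin_qp s t * lin_qp s' t' - lin_qp s' t' * lin_qp s t =
     const (t * s' - s * t') * (free_p * free_q - free_q * free_p)"
  by (simp add: free_q_def free_p_def mult_single algebra_simps single_diff plus_word_def zero_word_def)

lemma lin_qp_comb:
  "const a * lin_qp s t + const b * lin_qp s' t' = lin_qp (a * s + b * s') (a * t + b * t')"
  by (simp add: algebra_simps mult_single single_add flip: mult.assoc)

lemma lin_qp_commutator_cong:
  "weyl_cong hbar (lin_qp s t * lin_qp s' t')
     (lin_qp s' t' * lin_qp s t + const ((t * s' - s * t') * hbar))"
proof -
  have "lin_qp s t * lin_qp s' t' - (lin_qp s' t' * lin_qp s t + const ((t * s' - s * t') * hbar)) =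
    const (t * s' - s * t') * (free_p * free_q - free_q * free_p - const hbar)"
    using lin_qp_commutator[of s t s' t'] by (simp add: mult_single right_diff_distrib diff_diff_eq[symmetric])
  then show ?thesis
    by (simp add: weyl_cong_def weyl_ideal_mult_left weyl_ideal_rel)
qed

text \<open>
  The classical solutions of \<open>h (x - 1) - 2 g h x + h (x + 1) = 0\<close>, where \<open>2 g\<close> stands for
  \<open>\<alpha> + \<alpha>\<inverse>\<close>: \<open>hat x\<close> is the image of the generator at \<open>x\<close> in the Weyl algebra.
\<close>

locale oscillator =
  fixes g hbar :: "'r::comm_ring_1"
begin

text \<open>These are the Chebyshev values T_n(g) and U_(n-1)(g), the entries obtained from q by n
  steps. In this form only \<open>g\<close> enters, not the powers of \<alpha> that solve the
  recurrence in closed form.\<close>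

primrec qp_coeffs :: "nat \<Rightarrow> 'r \<times> 'r" where
  "qp_coeffs 0 = (1, 0)"
| "qp_coeffs (Suc n) =
     (g * fst (qp_coeffs n) + (g\<^sup>2 - 1) * snd (qp_coeffs n), fst (qp_coeffs n) + g * snd (qp_coeffs n))"

text \<open>Reflection of the line at 0 preserves the equation of motion, fixes q and negates p.
  Hence this coefficient is even in the site and \<open>p_coeff\<close> is odd.\<close>

definition q_coeff :: "int \<Rightarrow> 'r" where
  "q_coeff x = fst (qp_coeffs (nat \<bar>x\<bar>))"

definition p_coeff :: "int \<Rightarrow> 'r" where
  "p_coeff x = (if x < 0 then - snd (qp_coeffs (nat \<bar>x\<bar>)) else snd (qp_coeffs (nat \<bar>x\<bar>)))"

lemma qp_coeff_0 [simp]: "q_coeff 0 = 1" "p_coeff 0 = 0"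
  by (simp_all add: q_coeff_def p_coeff_def)

lemma qp_coeff_succ:
  "q_coeff (x + 1) = g * q_coeff x + (g\<^sup>2 - 1) * p_coeff x"
  "p_coeff (x + 1) = q_coeff x + g * p_coeff x"
proof -
  have "q_coeff (x + 1) = g * q_coeff x + (g\<^sup>2 - 1) * p_coeff x \<and> p_coeff (x + 1) = q_coeff x + g * p_coeff x"
  proof (cases "x \<ge> 0")
    case True
    then have "nat \<bar>x + 1\<bar> = Suc (nat \<bar>x\<bar>)" by simp
    with True show ?thesis by (simp add: q_coeff_def p_coeff_def)
  next
    case False
    then obtain n where x: "x = - int (Suc n)" by (metis int_cases not_le negative_zle_0 of_nat_0_le_iff)
    \<comment> \<open>For n = 0 the site x + 1 = 0 falls into the other branch of
      \<open>p_coeff\<close>; both branches agree there, as the value is 0.\<close>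
    have "nat \<bar>x\<bar> = Suc n" "nat \<bar>x + 1\<bar> = n" "x + 1 < 0 \<or> n = 0" using x by auto
    with False show ?thesis
      by (auto simp: q_coeff_def p_coeff_def x algebra_simps power2_eq_square)
  qed
  then show "q_coeff (x + 1) = g * q_coeff x + (g\<^sup>2 - 1) * p_coeff x"
    "p_coeff (x + 1) = q_coeff x + g * p_coeff x" by auto
qed

lemma qp_coeff_pred:
  "q_coeff (x - 1) = g * q_coeff x - (g\<^sup>2 - 1) * p_coeff x"
  "p_coeff (x - 1) = g * p_coeff x - q_coeff x"
proof -
  have "q_coeff x = g * q_coeff (x - 1) + (g\<^sup>2 - 1) * p_coeff (x - 1)"
    "p_coeff x = q_coeff (x - 1) + g * p_coeff (x - 1)"
    using qp_coeff_succ[of "x - 1"] by simp_all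
  then show "q_coeff (x - 1) = g * q_coeff x - (g\<^sup>2 - 1) * p_coeff x"
    "p_coeff (x - 1) = g * p_coeff x - q_coeff x"
    by (simp_all only:) (simp_all add: algebra_simps power2_eq_square)
qed

text \<open>Pell's equation: the step matrix and its inverse preserve the form s^2 - (g^2 - 1) t^2,
  which is 1 at site 0.\<close>

lemma qp_coeff_norm: "(q_coeff x)\<^sup>2 - (g\<^sup>2 - 1) * (p_coeff x)\<^sup>2 = 1"
proof (induction x rule: int_induct[where k = 0])
  case (step1 i)
  then show ?case unfolding qp_coeff_succ by (simp add: algebra_simps power2_eq_square)
next
  case (step2 i)
  then show ?case unfolding qp_coeff_pred by (simp add: algebra_simps power2_eq_square)
qed simp

text \<open>The discrete Wronskian of the two coefficient sequences. It serves twice: as the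
  coefficient of hbar in the commutator of neighbouring hats, and as the determinant inverted when q
  and p are recovered from them.\<close>

lemma qp_coeff_det: "q_coeff x * p_coeff (x + 1) - q_coeff (x + 1) * p_coeff x = 1"
  using qp_coeff_norm[of x] unfolding qp_coeff_succ by (simp add: algebra_simps power2_eq_square)

definition hat :: "int \<Rightarrow> 'r free_alg" where
  "hat x = lin_qp (q_coeff x) (p_coeff x)"

lemma hat_commute: "weyl_cong hbar (hat (x + 1) * hat x) (hat x * hat (x + 1) + const hbar)"
proof -
  have "p_coeff (x + 1) * q_coeff x - q_coeff (x + 1) * p_coeff x = 1"
    using qp_coeff_det[of x] by (simp add: mult.commute)
  then show ?thesis
    using lin_qp_commutator_cong[of hbar "q_coeff (x + 1)" "p_coeff (x + 1)" "q_coeff x" "p_coeff x"]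
    by (simp add: hat_def)
qed

text \<open>Passing each of the n copies of \<open>hat x\<close> costs one hbar, so the commutator
  acts as hbar times a derivative. At n = 0 the truncated exponent does no harm because its
  coefficient is 0.\<close>

lemma hat_commute_power:
  "weyl_cong hbar (hat (x + 1) * hat x ^ n)
     (hat x ^ n * hat (x + 1) + of_nat n * const hbar * hat x ^ (n - 1))"
proof (induction n)
  case (Suc n)
  have eq: "hat x * (of_nat n * const hbar * hat x ^ (n - 1)) = of_nat n * const hbar * hat x ^ n"
  proof (cases n)
    case (Suc m)
    have "hat x * (const (of_nat n * hbar) * hat x ^ m) = const (of_nat n * hbar) * (hat x * hat x ^ m)"
      by (metis const_mult_commute mult.assoc)
    then show ?thesis by (simp add: Suc mult_single flip: single_of_nat)
  qed simp
  have "hat (x + 1) * hat x ^ Suc n = hat (x + 1) * hat x * hat x ^ n"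
    by (simp add: mult.assoc)
  also have "weyl_cong hbar \<dots> ((hat x * hat (x + 1) + const hbar) * hat x ^ n)"
    by (rule weyl_cong_mult_right[OF hat_commute])
  also have "\<dots> = hat x * (hat (x + 1) * hat x ^ n) + const hbar * hat x ^ n"
    by (simp add: algebra_simps)
  also have "weyl_cong hbar \<dots> (hat x * (hat x ^ n * hat (x + 1) + of_nat n * const hbar * hat x ^ (n - 1))
      + const hbar * hat x ^ n)"
    by (intro weyl_cong_add weyl_cong_mult_left Suc.IH weyl_cong_refl)
  also have "\<dots> = hat x ^ Suc n * hat (x + 1) + of_nat (Suc n) * const hbar * hat x ^ (Suc n - 1)"
    by (simp only: distrib_left eq) (simp add: algebra_simps)
  finally show ?case .
qed simp

lemma hat_recurrence: "hat (x - 1) + hat (x + 1) = const (2 * g) * hat x"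
proof -
  have "hat (x - 1) + hat (x + 1) =
      lin_qp (q_coeff (x - 1) + q_coeff (x + 1)) (p_coeff (x - 1) + p_coeff (x + 1))"
    by (simp add: hat_def single_add algebra_simps)
  also have "\<dots> = lin_qp (2 * g * q_coeff x) (2 * g * p_coeff x)"
    by (rule arg_cong2[where f = lin_qp]) (simp_all add: qp_coeff_succ qp_coeff_pred)
  also have "\<dots> = const (2 * g) * hat x"
    by (simp add: hat_def distrib_left mult_single flip: mult.assoc)
  finally show ?thesis .
qed

section \<open>Translation by one site as a substitution in the Weyl algebra\<close>

text \<open>The images are \<open>hat 1\<close> and half of \<open>hat 2 - hat 0\<close>, with the
  division carried out: translation applied to q = \<open>hat 0\<close> and to p, which is half of
  \<open>hat 1 - hat (- 1)\<close>.\<close>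

definition step_subst :: "weyl_gen \<Rightarrow> 'r free_alg" where
  "step_subst x = (case x of Gen_q \<Rightarrow> lin_qp g 1 | Gen_p \<Rightarrow> lin_qp (g\<^sup>2 - 1) g)"

definition step_back_subst :: "weyl_gen \<Rightarrow> 'r free_alg" where
  "step_back_subst x = (case x of Gen_q \<Rightarrow> lin_qp g (- 1) | Gen_p \<Rightarrow> lin_qp (1 - g\<^sup>2) g)"

definition weyl_step :: "'r free_alg \<Rightarrow> 'r free_alg" where
  "weyl_step = free_subst step_subst"

definition weyl_step_back :: "'r free_alg \<Rightarrow> 'r free_alg" where
  "weyl_step_back = free_subst step_back_subst"

lemma weyl_step_lin_qp:
  "weyl_step (lin_qp s t) = lin_qp (s * g + t * (g\<^sup>2 - 1)) (s + t * g)"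
  "weyl_step_back (lin_qp s t) = lin_qp (s * g + t * (1 - g\<^sup>2)) (t * g - s)"
  using lin_qp_comb[of s g 1 t "g\<^sup>2 - 1" g] lin_qp_comb[of s g "- 1" t "1 - g\<^sup>2" g]
  by (simp_all add: weyl_step_def weyl_step_back_def step_subst_def step_back_subst_def)

lemma weyl_step_hat: "weyl_step (hat x) = hat (x + 1)"
  unfolding hat_def weyl_step_lin_qp qp_coeff_succ by (simp add: mult.commute add.commute)

lemma weyl_step_back_step [simp]: "weyl_step_back (weyl_step w) = w"
proof -
  have "weyl_step_back (step_subst Gen_q) = free_q" "weyl_step_back (step_subst Gen_p) = free_p"
    unfolding step_subst_def by (simp_all only: weyl_gen.case weyl_step_lin_qp)
      (simp_all add: algebra_simps power2_eq_square)
  then show ?thesis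
    unfolding weyl_step_def weyl_step_back_def free_subst_comp by (intro free_subst_id) auto
qed

lemma weyl_step_step_back [simp]: "weyl_step (weyl_step_back w) = w"
proof -
  have "weyl_step (step_back_subst Gen_q) = free_q" "weyl_step (step_back_subst Gen_p) = free_p"
    unfolding step_back_subst_def by (simp_all only: weyl_gen.case weyl_step_lin_qp)
      (simp_all add: algebra_simps power2_eq_square)
  then show ?thesis
    unfolding weyl_step_def weyl_step_back_def free_subst_comp by (intro free_subst_id) auto
qed

text \<open>The preimage of the ideal under a substitution is again a two-sided ideal, so the
  defining relation is all that has to be checked. For the linear substitutions used here this
  amounts to determinant 1.\<close>

lemma free_subst_weyl_ideal:
  assumes "weyl_cong hbar (s Gen_p * s Gen_q) (s Gen_q * s Gen_p + const hbar)"
    and "weyl_cong hbar v w"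
  shows "weyl_cong hbar (free_subst s v) (free_subst s w)"
proof -
  have "weyl_ideal hbar \<subseteq> {u. free_subst s u \<in> weyl_ideal hbar}"
    by (rule weyl_ideal_minimal)
      (use assms(1) in \<open>auto simp: linear_pm_zero[OF linear_pm_free_subst] weyl_ideal_zero
        weyl_ideal_add weyl_ideal_mult_left weyl_ideal_mult_right weyl_cong_def diff_diff_eq\<close>)
  then show ?thesis using assms(2) by (auto simp: weyl_cong_def)
qed

lemma weyl_step_cong: "weyl_cong hbar v w \<Longrightarrow> weyl_cong hbar (weyl_step v) (weyl_step w)"
  unfolding weyl_step_def
  using lin_qp_commutator_cong[of hbar "g\<^sup>2 - 1" g g 1]
  by (intro free_subst_weyl_ideal) (simp_all add: step_subst_def power2_eq_square)

lemma weyl_step_back_cong: "weyl_cong hbar v w \<Longrightarrow> weyl_cong hbar (weyl_step_back v) (weyl_step_back w)"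
  unfolding weyl_step_back_def
  using lin_qp_commutator_cong[of hbar "1 - g\<^sup>2" g g "- 1"]
  by (intro free_subst_weyl_ideal) (simp_all add: step_back_subst_def power2_eq_square)

end


section \<open>Polynomials in the even generators\<close>

abbreviation gen :: "int \<Rightarrow> 'r::comm_ring_1 pol" where
  "gen x \<equiv> Poly_Mapping.single (Poly_Mapping.single x 1) 1"

definition pol_on :: "int set \<Rightarrow> 'r::comm_ring_1 pol set" where
  "pol_on S = {P. Poly_Mapping.keys P \<subseteq> {m. Poly_Mapping.keys m \<subseteq> S}}"

lemma keys_add_nat:
  "Poly_Mapping.keys (m + n) = Poly_Mapping.keys m \<union> Poly_Mapping.keys (n :: 'a \<Rightarrow>\<^sub>0 nat)"
  by (auto simp: in_keys_iff lookup_add)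

lemma keys_minus_nat:
  "Poly_Mapping.keys (m - n) \<subseteq> Poly_Mapping.keys (m :: 'a \<Rightarrow>\<^sub>0 nat)"
  by (auto simp: in_keys_iff lookup_minus)

lemma pol_on_single: "Poly_Mapping.keys m \<subseteq> S \<Longrightarrow> Poly_Mapping.single m c \<in> pol_on S"
  by (simp add: pol_on_def)

lemma pol_on_zero [simp]: "0 \<in> pol_on S"
  by (simp add: pol_on_def)

lemma pol_on_const [simp]: "const c \<in> pol_on S"
  by (simp add: pol_on_single)

lemma pol_on_gen [simp]: "x \<in> S \<Longrightarrow> gen x \<in> pol_on S"
  by (simp add: pol_on_single)

lemma pol_on_add: "P \<in> pol_on S \<Longrightarrow> Q \<in> pol_on S \<Longrightarrow> P + Q \<in> pol_on S"
  using keys_add[of P Q] by (auto simp: pol_on_def)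

lemma pol_on_mult: "P \<in> pol_on S \<Longrightarrow> Q \<in> pol_on S \<Longrightarrow> P * Q \<in> pol_on S"
  using keys_mult[of P Q] by (fastforce simp: pol_on_def keys_add_nat)

lemma pol_on_uminus: "P \<in> pol_on S \<Longrightarrow> - P \<in> pol_on S"
  by (simp add: pol_on_def)

lemma pol_on_diff: "P \<in> pol_on S \<Longrightarrow> Q \<in> pol_on S \<Longrightarrow> P - Q \<in> pol_on S"
  using pol_on_add[of P S "- Q"] by (simp add: pol_on_uminus)

lemma pol_on_sum: "(\<And>i. i \<in> A \<Longrightarrow> f i \<in> pol_on S) \<Longrightarrow> (\<Sum>i\<in>A. f i) \<in> pol_on S"
  by (induction A rule: infinite_finite_induct) (auto intro: pol_on_add)

lemma pol_on_mono: "S \<subseteq> T \<Longrightarrow> P \<in> pol_on S \<Longrightarrow> P \<in> pol_on T"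
  by (auto simp: pol_on_def)

lemma pol_on_induct [consumes 1, case_names zero add single]:
  assumes "P \<in> pol_on S" "\<Phi> 0" "\<And>P Q. \<Phi> P \<Longrightarrow> \<Phi> Q \<Longrightarrow> \<Phi> (P + Q)"
    and "\<And>m c. Poly_Mapping.keys m \<subseteq> S \<Longrightarrow> \<Phi> (Poly_Mapping.single m c)"
  shows "\<Phi> P"
  by (rule poly_mapping_span_induct[of P "{m. Poly_Mapping.keys m \<subseteq> S}"])
    (use assms in \<open>auto simp: pol_on_def\<close>)

text \<open>Supplies one finite window containing all variables that occur together with a
  prescribed region, so that ordered products can run over a list of consecutive sites.\<close>

lemma ex_pol_on: "\<exists>l r. l \<le> a \<and> b \<le> r \<and> P \<in> pol_on {l..r}"
proof -
  define A where "A = insert a (insert b (\<Union>m\<in>Poly_Mapping.keys P. Poly_Mapping.keys m))"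
  have fin: "finite A" by (simp add: A_def)
  have "Min A \<le> a" "b \<le> Max A"
    using Min_le[OF fin, of a] Max_ge[OF fin, of b] by (simp_all add: A_def)
  moreover have "P \<in> pol_on {Min A..Max A}"
    using Min_le[OF fin] Max_ge[OF fin] by (fastforce simp: pol_on_def A_def)
  ultimately show ?thesis by blast
qed

lemma ex_keys_interval: "\<exists>l r. l \<le> a \<and> b \<le> r \<and> Poly_Mapping.keys m \<subseteq> {l..r}"
  for a b :: int and m :: "int \<Rightarrow>\<^sub>0 nat"
  using ex_pol_on[of a b "Poly_Mapping.single m (1::int)"] by (simp add: pol_on_def)


subsection \<open>Partial derivatives\<close>

lemma pol_partial_eq_lin_ext:
  "pol_partial x = lin_ext (\<lambda>m. Poly_Mapping.single (m - Poly_Mapping.single x 1) (of_nat (Poly_Mapping.lookup m x)))"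
  by (rule ext) (simp add: pol_partial_def lin_ext_def const_mult_single mult.commute)

lemma linear_pm_pol_partial: "linear_pm (pol_partial x)"
  unfolding pol_partial_eq_lin_ext by (rule linear_pm_lin_ext)

lemma pol_partial_single:
  "pol_partial x (Poly_Mapping.single m c) =
     Poly_Mapping.single (m - Poly_Mapping.single x 1) (c * of_nat (Poly_Mapping.lookup m x))"
  unfolding pol_partial_eq_lin_ext by (simp add: lin_ext_single const_mult_single)

lemma pol_on_pol_partial: "P \<in> pol_on S \<Longrightarrow> pol_partial x P \<in> pol_on S"
proof (induction rule: pol_on_induct)
  case (single m c)
  then show ?case
    using keys_minus_nat[of m] by (force simp: pol_partial_single intro: pol_on_single)
qed (auto simp: linear_pm_zero linear_pm_add linear_pm_pol_partial pol_on_add)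

text \<open>The canonical commutation of a derivative with multiplication by its variable, from
  which the representation gets the Weyl relation.\<close>

lemma pol_partial_gen_mult: "pol_partial x (gen x * P) = P + gen x * pol_partial x P"
proof (rule linear_pm_eqI[of "\<lambda>P. pol_partial x (gen x * P)" "\<lambda>P. P + gen x * pol_partial x P"])
  fix m :: "int \<Rightarrow>\<^sub>0 nat"
  \<comment> \<open>Subtraction of exponents is truncated, so it undoes the addition only if x
    occurs in m; otherwise the derivative of the monomial is 0.\<close>
  have *: "Poly_Mapping.single x 1 + (m - Poly_Mapping.single x 1) = m" if "Poly_Mapping.lookup m x \<noteq> 0"
    using that by (intro poly_mapping_eqI) (auto simp: lookup_add lookup_minus lookup_single when_def)
  show "pol_partial x (gen x * Poly_Mapping.single m 1) =
      Poly_Mapping.single m 1 + gen x * pol_partial x (Poly_Mapping.single m (1 :: 'a))"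
    using * by (cases "Poly_Mapping.lookup m x = 0")
      (simp_all add: mult_single pol_partial_single lookup_add single_add)
qed (intro linear_pm_comp[OF linear_pm_pol_partial] linear_pm_plus linear_pm_mult_left
    linear_pm_id linear_pm_pol_partial)+


subsection \<open>Shifts\<close>

lemma lookup_shift_mon: "Poly_Mapping.lookup (shift_mon n m) y = Poly_Mapping.lookup m (y - n)"
proof -
  have *: "x + n = y \<longleftrightarrow> x = y - n" for x by auto
  show ?thesis
    by (simp add: shift_mon_def lookup_sum lookup_single when_def * in_keys_iff)
qed

lemma keys_shift_mon: "Poly_Mapping.keys (shift_mon n m) = (\<lambda>x. x + n) ` Poly_Mapping.keys m"
  by (force simp: in_keys_iff lookup_shift_mon image_iff)

lemma shift_pol_eq_lin_ext: "shift_pol n = lin_ext (\<lambda>m. Poly_Mapping.single (shift_mon n m) 1)"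
  by (rule ext) (simp add: shift_pol_def lin_ext_def const_mult_single)

lemma linear_pm_shift_pol: "linear_pm (shift_pol n)"
  unfolding shift_pol_eq_lin_ext by (rule linear_pm_lin_ext)

lemma shift_pol_single:
  "shift_pol n (Poly_Mapping.single m c) = Poly_Mapping.single (shift_mon n m) c"
  unfolding shift_pol_eq_lin_ext by (simp add: lin_ext_single const_mult_single)

lemma pol_on_shift_pol: "P \<in> pol_on S \<Longrightarrow> shift_pol n P \<in> pol_on ((\<lambda>x. x + n) ` S)"
proof (induction rule: pol_on_induct)
  case (single m c)
  then show ?case
    unfolding shift_pol_single by (intro pol_on_single) (simp add: keys_shift_mon image_mono)
qed (auto simp: linear_pm_zero linear_pm_add linear_pm_shift_pol pol_on_add)


section \<open>Time-ordered products\<close>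

lemma upto_split_list:
  assumes "l \<le> k + 1" "k \<le> (r :: int)"
  shows "[l..r] = [l..k] @ [k + 1..r]"
  using upto_split1[of l "k + 1" r] assms by (cases "k = r") auto

lemma map_upto_succ: "map f [l + 1..r + 1] = map (\<lambda>x. f (x + 1)) [l..r :: int]"
proof (induction l r rule: upto.induct)
  case (1 i j)
  then show ?case
    using upto_rec1[of i j] upto_rec1[of "i + 1" "j + 1"] by (cases "i \<le> j") auto
qed

context oscillator
begin

definition hat_mon :: "(int \<Rightarrow>\<^sub>0 nat) \<Rightarrow> 'r free_alg" where
  "hat_mon m = prod_list (map (\<lambda>x. hat x ^ Poly_Mapping.lookup m x)
     (sorted_list_of_set (Poly_Mapping.keys m)))"

definition time_ordered :: "'r pol \<Rightarrow> 'r free_alg" where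
  "time_ordered = lin_ext hat_mon"

text \<open>Sites outside the support contribute a zeroth power, so the product may run over any
  window. Different monomials can then be compared factor by factor.\<close>

lemma hat_mon_upto:
  assumes "Poly_Mapping.keys m \<subseteq> {l..r}"
  shows "hat_mon m = prod_list (map (\<lambda>x. hat x ^ Poly_Mapping.lookup m x) [l..r])"
proof -
  let ?F = "filter (\<lambda>x. x \<in> Poly_Mapping.keys m) [l..r]"
  have "set ?F = Poly_Mapping.keys m" using assms by auto
  moreover have "sorted_list_of_set (set ?F) = ?F"
    by (intro sorted_list_of_set.idem_if_sorted_distinct) (simp_all add: sorted_wrt_filter)
  moreover have "prod_list (map (\<lambda>x. hat x ^ Poly_Mapping.lookup m x) (filter (\<lambda>x. x \<in> Poly_Mapping.keys m) xs)) =
      prod_list (map (\<lambda>x. hat x ^ Poly_Mapping.lookup m x) xs)" for xs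
    by (induction xs) (simp_all add: in_keys_iff)
  ultimately show ?thesis
    by (simp add: hat_mon_def)
qed

lemma linear_pm_time_ordered: "linear_pm time_ordered"
  unfolding time_ordered_def by (rule linear_pm_lin_ext)

lemma time_ordered_single: "time_ordered (Poly_Mapping.single m c) = const c * hat_mon m"
  by (simp add: time_ordered_def lin_ext_single)

lemma time_ordered_const: "time_ordered (const c) = const c"
  by (simp add: time_ordered_single hat_mon_def)

lemma hat_mon_single: "hat_mon (Poly_Mapping.single x k) = hat x ^ k"
  by (cases "k = 0") (simp_all add: hat_mon_def)

lemma time_ordered_gen: "time_ordered (gen x) = hat x"
  by (simp add: time_ordered_single hat_mon_single)

lemma hat_mon_shift_mon: "hat_mon (shift_mon 1 m) = weyl_step (hat_mon m)"
proof -
  obtain l r where lr: "Poly_Mapping.keys m \<subseteq> {l..r}"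
    using ex_keys_interval[of 0 0 m] by auto
  have step: "weyl_step (prod_list (map f xs)) = prod_list (map (\<lambda>x. weyl_step (f x)) xs)" for f and xs :: "int list"
    by (induction xs) (simp_all add: weyl_step_def)
  have pow: "weyl_step (hat x ^ n) = hat (x + 1) ^ n" for x n
    using weyl_step_hat[of x] by (simp add: weyl_step_def)
  have "Poly_Mapping.keys (shift_mon 1 m) \<subseteq> {l + 1..r + 1}"
    using lr by (auto simp: keys_shift_mon)
  then show ?thesis
    by (simp add: hat_mon_upto[OF lr] hat_mon_upto step pow map_upto_succ lookup_shift_mon)
qed

lemma time_ordered_shift: "time_ordered (shift_pol 1 P) = weyl_step (time_ordered P)"
proof (rule linear_pm_eqI[of "\<lambda>P. time_ordered (shift_pol 1 P)" "\<lambda>P. weyl_step (time_ordered P)"])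
  show "linear_pm (\<lambda>P. weyl_step (time_ordered P))"
    unfolding weyl_step_def by (rule linear_pm_comp[OF linear_pm_free_subst linear_pm_time_ordered])
  show "linear_pm (\<lambda>P. time_ordered (shift_pol 1 P))"
    by (rule linear_pm_comp[OF linear_pm_time_ordered linear_pm_shift_pol])
qed (simp add: shift_pol_single time_ordered_single hat_mon_shift_mon)

lemma hat_mon_add:
  assumes "Poly_Mapping.keys m \<subseteq> {..k}" "Poly_Mapping.keys n \<subseteq> {k + 1..}"
  shows "hat_mon (m + n) = hat_mon m * hat_mon n"
proof -
  obtain l r where lr: "l \<le> k" "k \<le> r" "Poly_Mapping.keys (m + n) \<subseteq> {l..r}"
    using ex_keys_interval[of k k "m + n"] by auto
  have m0: "Poly_Mapping.lookup m x = 0" if "x > k" for x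
    using that assms(1) by (force simp: in_keys_iff)
  have n0: "Poly_Mapping.lookup n x = 0" if "x \<le> k" for x
    using that assms(2) by (force simp: in_keys_iff)
  have split: "[l..r] = [l..k] @ [k + 1..r]"
    using lr by (intro upto_split_list) auto
  have triv: "prod_list (map (\<lambda>_. 1 :: 'r free_alg) xs) = 1" for xs :: "int list"
    by (induction xs) auto
  have "hat_mon (m + n) = prod_list (map (\<lambda>x. hat x ^ Poly_Mapping.lookup m x) [l..k])
      * prod_list (map (\<lambda>x. hat x ^ Poly_Mapping.lookup n x) [k + 1..r])"
    unfolding hat_mon_upto[OF lr(3)] split map_append prod_list.append
    by (intro arg_cong2[where f = "(*)"] arg_cong[where f = prod_list] map_cong)
      (auto simp: lookup_add m0 n0)
  also have "prod_list (map (\<lambda>x. hat x ^ Poly_Mapping.lookup m x) [l..k]) = hat_mon m"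
    using assms(1) lr(3) by (intro hat_mon_upto[symmetric]) (auto simp: keys_add_nat subset_iff)
  also have "prod_list (map (\<lambda>x. hat x ^ Poly_Mapping.lookup n x) [k + 1..r]) = hat_mon n"
    using assms(2) lr(3) by (intro hat_mon_upto[symmetric]) (auto simp: keys_add_nat subset_iff)
  finally show ?thesis .
qed

text \<open>No factor has to cross another: the cut after k splits each increasing product in two.
  This makes the factorization product of a left and a right interval the product of the Weyl
  algebra.\<close>

lemma time_ordered_mult:
  assumes "P \<in> pol_on {..k}" "Q \<in> pol_on {k + 1..}"
  shows "time_ordered (P * Q) = time_ordered P * time_ordered Q"
proof (rule linear_pm_eq_on[of "\<lambda>P. time_ordered (P * Q)" "\<lambda>P. time_ordered P * time_ordered Q"
      P "{m. Poly_Mapping.keys m \<subseteq> {..k}}"])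
  fix m :: "int \<Rightarrow>\<^sub>0 nat" assume m: "m \<in> {m. Poly_Mapping.keys m \<subseteq> {..k}}"
  let ?P = "Poly_Mapping.single m 1 :: 'r pol"
  show "time_ordered (?P * Q) = time_ordered ?P * time_ordered Q"
  proof (rule linear_pm_eq_on[of "\<lambda>Q. time_ordered (?P * Q)" "\<lambda>Q. time_ordered ?P * time_ordered Q"
      Q "{m. Poly_Mapping.keys m \<subseteq> {k + 1..}}"])
    fix n :: "int \<Rightarrow>\<^sub>0 nat" assume "n \<in> {m. Poly_Mapping.keys m \<subseteq> {k + 1..}}"
    with m show "time_ordered (?P * Poly_Mapping.single n 1) = time_ordered ?P * time_ordered (Poly_Mapping.single n 1)"
      by (simp add: mult_single time_ordered_single hat_mon_add)
  qed (use assms in \<open>auto simp: pol_on_def intro!: linear_pm_mult_left linear_pm_comp[OF linear_pm_time_ordered] linear_pm_time_ordered\<close>)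
qed (use assms in \<open>auto simp: pol_on_def intro!: linear_pm_mult_right linear_pm_comp[OF linear_pm_time_ordered] linear_pm_time_ordered\<close>)


section \<open>Degree zero coboundaries\<close>

text \<open>The quantum differential of \<open>P\<close> times the odd generator at
  \<open>x\<close>, with \<open>2 * g\<close> in place of \<alpha> + 1/\<alpha>; compare
  \<open>d_quantum_deg_1\<close>.\<close>

definition relator :: "int \<Rightarrow> 'r pol \<Rightarrow> 'r pol" where
  "relator x P = (gen (x - 1) - const (2 * g) * gen x + gen (x + 1)) * P + const hbar * pol_partial x P"

lemma linear_pm_relator: "linear_pm (relator x)"
  unfolding relator_def
  by (intro linear_pm_plus linear_pm_mult_left linear_pm_id linear_pm_pol_partial)

lemma pol_on_relator:
  "P \<in> pol_on {l..r} \<Longrightarrow> x \<in> {l<..<r} \<Longrightarrow> relator x P \<in> pol_on {l..r}"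
  unfolding relator_def
  by (intro pol_on_add pol_on_mult pol_on_diff pol_on_gen pol_on_const pol_on_pol_partial) auto

lemma relator_single:
  "relator x (Poly_Mapping.single m 1) =
     Poly_Mapping.single (Poly_Mapping.single (x - 1) 1 + m) 1
     - Poly_Mapping.single (Poly_Mapping.single x 1 + m) (2 * g)
     + Poly_Mapping.single (Poly_Mapping.single (x + 1) 1 + m) 1
     + Poly_Mapping.single (m - Poly_Mapping.single x 1) (hbar * of_nat (Poly_Mapping.lookup m x))"
  unfolding relator_def by (simp add: distrib_right left_diff_distrib mult_single pol_partial_single)

text \<open>The degree 0 coboundaries of an interval with sites l, ..., r: odd generators exist at
  interior sites only, while their coefficients may involve the end sites.\<close>

definition relators :: "int \<Rightarrow> int \<Rightarrow> 'r pol set" where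
  "relators l r = {\<Sum>x\<in>{l<..<r}. relator x (P x) | P. \<forall>x\<in>{l<..<r}. P x \<in> pol_on {l..r}}"

lemma relators_zero [simp]: "0 \<in> relators l r"
  unfolding relators_def mem_Collect_eq
  by (rule exI[of _ "\<lambda>_. 0"]) (simp add: linear_pm_zero[OF linear_pm_relator])

lemma relators_add:
  assumes "P \<in> relators l r" "Q \<in> relators l r"
  shows "P + Q \<in> relators l r"
proof -
  obtain F G where "P = (\<Sum>x\<in>{l<..<r}. relator x (F x))" "\<forall>x\<in>{l<..<r}. F x \<in> pol_on {l..r}"
    "Q = (\<Sum>x\<in>{l<..<r}. relator x (G x))" "\<forall>x\<in>{l<..<r}. G x \<in> pol_on {l..r}"
    using assms unfolding relators_def by blast
  then show ?thesis
    unfolding relators_def mem_Collect_eq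
    by (intro exI[of _ "\<lambda>x. F x + G x"])
      (simp add: linear_pm_add[OF linear_pm_relator] sum.distrib pol_on_add)
qed

lemma relators_scale:
  assumes "P \<in> relators l r"
  shows "const c * P \<in> relators l r"
proof -
  obtain F where "P = (\<Sum>x\<in>{l<..<r}. relator x (F x))" "\<forall>x\<in>{l<..<r}. F x \<in> pol_on {l..r}"
    using assms unfolding relators_def by blast
  then show ?thesis
    unfolding relators_def mem_Collect_eq
    by (intro exI[of _ "\<lambda>x. const c * F x"])
      (simp add: linear_pm_scale[OF linear_pm_relator] sum_distrib_left pol_on_mult)
qed

lemma relators_uminus: "P \<in> relators l r \<Longrightarrow> - P \<in> relators l r"
  using relators_scale[of P l r "- 1"] by (simp add: single_uminus)

lemma relators_diff: "P \<in> relators l r \<Longrightarrow> Q \<in> relators l r \<Longrightarrow> P - Q \<in> relators l r"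
  using relators_add[of P l r "- Q"] by (simp add: relators_uminus)

lemma relator_in_relators:
  assumes "x \<in> {l<..<r}" "P \<in> pol_on {l..r}"
  shows "relator x P \<in> relators l r"
  unfolding relators_def mem_Collect_eq
proof (intro exI[of _ "\<lambda>y. if y = x then P else 0"] conjI)
  have "(\<Sum>y\<in>{l<..<r}. relator y (if y = x then P else 0)) = (\<Sum>y\<in>{l<..<r}. if y = x then relator y P else 0)"
    by (rule sum.cong) (simp_all add: linear_pm_zero[OF linear_pm_relator])
  then show "relator x P = (\<Sum>y\<in>{l<..<r}. relator y (if y = x then P else 0))"
    using assms(1) by simp
qed (use assms in auto)

text \<open>The four terms differ only near x. Once \<open>hat (x - 1)\<close> is replaced by
  \<open>const (2 * g) * hat x - hat (x + 1)\<close>, what remains is the error of moving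
  \<open>hat (x + 1)\<close> across \<open>hat x ^ k\<close>, cancelled by the hbar term.\<close>

lemma time_ordered_relator_monomial:
  "weyl_cong hbar (time_ordered (relator x (Poly_Mapping.single m 1))) 0"
proof -
  obtain l r where lr: "l \<le> x - 1" "x + 1 \<le> r" "Poly_Mapping.keys m \<subseteq> {l..r}"
    using ex_keys_interval[of "x - 1" "x + 1" m] by auto
  define i k j where "i = Poly_Mapping.lookup m (x - 1)" "k = Poly_Mapping.lookup m x" "j = Poly_Mapping.lookup m (x + 1)"
  define L where "L = prod_list (map (\<lambda>y. hat y ^ Poly_Mapping.lookup m y) [l..x - 2])"
  define R where "R = prod_list (map (\<lambda>y. hat y ^ Poly_Mapping.lookup m y) [x + 2..r])"
  have split: "[l..r] = [l..x - 2] @ [x - 1, x, x + 1] @ [x + 2..r]"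
    using upto_split_list[of l "x - 2" r] upto_rec1[of "x - 1" r] upto_rec1[of x r] upto_rec1[of "x + 1" r] lr
    by (simp add: add.commute)
  have mon: "hat_mon n = L * hat (x - 1) ^ Poly_Mapping.lookup n (x - 1) * hat x ^ Poly_Mapping.lookup n x
      * hat (x + 1) ^ Poly_Mapping.lookup n (x + 1) * R"
    if "Poly_Mapping.keys n \<subseteq> {l..r}" "\<And>y. y \<notin> {x - 1, x, x + 1} \<Longrightarrow> Poly_Mapping.lookup n y = Poly_Mapping.lookup m y" for n
  proof -
    have e: "map (\<lambda>y. hat y ^ Poly_Mapping.lookup n y) [l..x - 2] = map (\<lambda>y. hat y ^ Poly_Mapping.lookup m y) [l..x - 2]"
      "map (\<lambda>y. hat y ^ Poly_Mapping.lookup n y) [x + 2..r] = map (\<lambda>y. hat y ^ Poly_Mapping.lookup m y) [x + 2..r]"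
      using that(2) by (auto intro!: map_cong)
    show ?thesis
      unfolding hat_mon_upto[OF that(1)] split L_def R_def map_append prod_list.append e
      by (simp add: mult.assoc)
  qed
  have add: "hat_mon (Poly_Mapping.single y 1 + m) = L * hat (x - 1) ^ (i + (if y = x - 1 then 1 else 0))
      * hat x ^ (k + (if y = x then 1 else 0)) * hat (x + 1) ^ (j + (if y = x + 1 then 1 else 0)) * R"
    if "y \<in> {x - 1, x, x + 1}" for y
  proof -
    have "Poly_Mapping.keys (Poly_Mapping.single y 1 + m) \<subseteq> {l..r}"
      using that lr by (auto simp: keys_add_nat)
    then show ?thesis
      using that by (subst mon) (auto simp: lookup_add lookup_single when_def i_k_j_def)
  qed
  have partial: "hat_mon (m - Poly_Mapping.single x 1) = L * hat (x - 1) ^ i * hat x ^ (k - 1) * hat (x + 1) ^ j * R"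
  proof -
    have "Poly_Mapping.keys (m - Poly_Mapping.single x 1) \<subseteq> {l..r}"
      using lr(3) keys_minus_nat[of m "Poly_Mapping.single x 1"] by blast
    then show ?thesis
      by (subst mon) (auto simp: lookup_minus lookup_single when_def i_k_j_def)
  qed
  \<comment> \<open>Outer factors common to all four terms: an extra \<open>hat (x - 1)\<close>
    joins its power at the right end, an extra \<open>hat (x + 1)\<close> at the left end, so both
    land next to the power of \<open>hat x\<close>.\<close>
  define U V where "U = L * hat (x - 1) ^ i" "V = hat (x + 1) ^ j * R"
  have pull: "const c * (U * w) = U * (const c * w)" for c w
    by (metis const_mult_commute mult.assoc)
  have h: "hat (x - 1) = const (2 * g) * hat x - hat (x + 1)"
    using hat_recurrence[of x] by (simp add: algebra_simps)
  have "time_ordered (relator x (Poly_Mapping.single m 1)) =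
      hat_mon (Poly_Mapping.single (x - 1) 1 + m) - const (2 * g) * hat_mon (Poly_Mapping.single x 1 + m)
      + hat_mon (Poly_Mapping.single (x + 1) 1 + m)
      + const (of_nat k * hbar) * hat_mon (m - Poly_Mapping.single x 1)"
    unfolding relator_single
    by (simp add: linear_pm_add[OF linear_pm_time_ordered] linear_pm_minus[OF linear_pm_time_ordered]
        time_ordered_single i_k_j_def mult.commute[of hbar])
  also have "\<dots> = U * hat (x - 1) * hat x ^ k * V - const (2 * g) * (U * hat x * hat x ^ k * V)
      + U * hat x ^ k * hat (x + 1) * V + const (of_nat k * hbar) * (U * hat x ^ (k - 1) * V)"
  proof -
    have "hat_mon (Poly_Mapping.single (x - 1) 1 + m) = U * hat (x - 1) * hat x ^ k * V"
      using add[of "x - 1"] by (simp add: U_V_def mult.assoc power_Suc2 del: power_Suc)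
    moreover have "hat_mon (Poly_Mapping.single x 1 + m) = U * hat x * hat x ^ k * V"
      using add[of x] by (simp add: U_V_def mult.assoc)
    moreover have "hat_mon (Poly_Mapping.single (x + 1) 1 + m) = U * hat x ^ k * hat (x + 1) * V"
      using add[of "x + 1"] by (simp add: U_V_def mult.assoc)
    moreover have "hat_mon (m - Poly_Mapping.single x 1) = U * hat x ^ (k - 1) * V"
      using partial by (simp add: U_V_def mult.assoc)
    ultimately show ?thesis by (simp only:)
  qed
  also have "\<dots> = U * (hat (x - 1) * hat x ^ k - const (2 * g) * (hat x * hat x ^ k)
      + hat x ^ k * hat (x + 1) + const (of_nat k * hbar) * hat x ^ (k - 1)) * V"
    by (simp add: mult.assoc pull algebra_simps)
  also have "\<dots> = U * (- (hat (x + 1) * hat x ^ k - (hat x ^ k * hat (x + 1)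
      + of_nat k * const hbar * hat x ^ (k - 1)))) * V"
  proof -
    have "const (of_nat k * hbar) = of_nat k * (const hbar :: 'r free_alg)"
      by (simp add: mult_single flip: single_of_nat)
    then show ?thesis unfolding h by (simp add: left_diff_distrib mult.assoc algebra_simps)
  qed
  finally show ?thesis
    using hat_commute_power[of x k]
    by (simp add: weyl_cong_def weyl_ideal_mult_left weyl_ideal_mult_right weyl_ideal_uminus del: minus_diff_eq)
qed

lemma time_ordered_relator: "weyl_cong hbar (time_ordered (relator x P)) 0"
proof -
  have "Poly_Mapping.keys P \<subseteq> UNIV" by simp
  then show ?thesis
  proof (induction rule: poly_mapping_span_induct)
    case zero
    show ?case by (simp add: linear_pm_zero linear_pm_relator linear_pm_time_ordered)
  next
    case (add P Q)
    then show ?case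
      using weyl_cong_add[OF add]
      by (simp add: linear_pm_add[OF linear_pm_relator] linear_pm_add[OF linear_pm_time_ordered])
  next
    case (single m c)
    show ?case
      using weyl_cong_mult_left[OF time_ordered_relator_monomial[of x m], of "const c"]
        linear_pm_single[OF linear_pm_comp[OF linear_pm_time_ordered linear_pm_relator, of x], of m c]
      by simp
  qed
qed

lemma time_ordered_relators:
  assumes "P \<in> relators l r"
  shows "weyl_cong hbar (time_ordered P) 0"
proof -
  have "weyl_cong hbar (time_ordered (\<Sum>x\<in>A. relator x (F x))) 0" for A and F :: "int \<Rightarrow> 'r pol"
  proof (induction A rule: infinite_finite_induct)
    case (insert x A)
    then show ?case
      using weyl_cong_add[OF time_ordered_relator[of x "F x"] insert.IH]
      by (simp add: linear_pm_add[OF linear_pm_time_ordered])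
  qed (simp_all add: linear_pm_zero[OF linear_pm_time_ordered])
  then show ?thesis using assms unfolding relators_def by blast
qed

section \<open>Reduction to two adjacent generators\<close>

text \<open>Induction on the total distance of the factors from l. A factor at z >= l + 2 belongs to
  the heaviest term of the relator centred at z - 1; the other terms move it to z - 1 or z - 2, or
  remove it together with a factor at z - 1.\<close>

lemma reduce_monomial:
  assumes "l < r" "Poly_Mapping.keys m \<subseteq> {l..r}"
  shows "\<exists>f\<in>pol_on {l, l + 1}. Poly_Mapping.single m 1 - f \<in> relators l r"
  using assms(2)
proof (induction "\<Sum>x\<in>{l..r}. Poly_Mapping.lookup m x * nat (x - l)" arbitrary: m rule: less_induct)
  case (less m)
  define w where "w n = (\<Sum>x\<in>{l..r}. Poly_Mapping.lookup n x * nat (x - l))" for n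
  have w_add: "w (a + b) = w a + w b" for a b
    by (simp add: w_def lookup_add distrib_right sum.distrib)
  have w_single: "w (Poly_Mapping.single y 1) = nat (y - l)" if "y \<in> {l..r}" for y
  proof -
    have "w (Poly_Mapping.single y 1) = (\<Sum>x\<in>{l..r}. if x = y then nat (y - l) else 0)"
      unfolding w_def by (rule sum.cong) (auto simp: lookup_single when_def)
    then show ?thesis using that by simp
  qed
  show ?case
  proof (cases "Poly_Mapping.keys m \<subseteq> {l, l + 1}")
    case True
    then show ?thesis by (intro bexI[of _ "Poly_Mapping.single m 1"]) (auto intro: pol_on_single)
  next
    case False
    then obtain z where z: "z \<in> Poly_Mapping.keys m" "z \<noteq> l" "z \<noteq> l + 1" by auto
    \<comment> \<open>Since l + 2 <= z <= r, the site z - 1 is interior and z - 2 is still in the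
      interval, so this relator is available.\<close>
    define x n where "x = z - 1" "n = m - Poly_Mapping.single z 1"
    have x: "x - 1 \<in> {l..r}" "x \<in> {l..r}" "x + 1 \<in> {l..r}" "x \<in> {l<..<r}" "l < x"
      using z less.prems by (force simp: x_n_def)+
    have m: "m = Poly_Mapping.single (x + 1) 1 + n"
      using z(1) by (intro poly_mapping_eqI) (auto simp: x_n_def lookup_add lookup_minus lookup_single when_def in_keys_iff)
    have n: "Poly_Mapping.keys n \<subseteq> {l..r}"
      using less.prems unfolding m by (simp add: keys_add_nat)
    have wm: "w m = nat (x + 1 - l) + w n"
      unfolding m w_add using w_single[OF x(3)] by simp
    have IH: "\<exists>f\<in>pol_on {l, l + 1}. Poly_Mapping.single k 1 - f \<in> relators l r"
      if "w k < w m" "Poly_Mapping.keys k \<subseteq> {l..r}" for k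
      using less.hyps[of k] that by (simp add: w_def)
    have "w (Poly_Mapping.single (x - 1) 1 + n) < w m" "w (Poly_Mapping.single x 1 + n) < w m"
      using x(5) unfolding wm w_add w_single[OF x(1)] w_single[OF x(2)] by auto
    \<comment> \<open>Truncated subtraction cannot raise the weight; strictness comes from the
      factor at x + 1 already removed from m.\<close>
    moreover have "w (n - Poly_Mapping.single x 1) < w m"
    proof -
      have "w (n - Poly_Mapping.single x 1) \<le> w n"
        unfolding w_def by (intro sum_mono mult_right_mono) (simp_all add: lookup_minus)
      then show ?thesis using x(5) unfolding wm by simp
    qed
    moreover have "Poly_Mapping.keys (n - Poly_Mapping.single x 1) \<subseteq> {l..r}"
      using n keys_minus_nat[of n "Poly_Mapping.single x 1"] by blast
    moreover have "Poly_Mapping.keys (Poly_Mapping.single (x - 1) 1 + n) \<subseteq> {l..r}"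
      "Poly_Mapping.keys (Poly_Mapping.single x 1 + n) \<subseteq> {l..r}"
      using n x by (auto simp: keys_add_nat)
    ultimately obtain f1 f2 f3 where
      f: "f1 \<in> pol_on {l, l + 1}" "f2 \<in> pol_on {l, l + 1}" "f3 \<in> pol_on {l, l + 1}" and
      rel: "Poly_Mapping.single (Poly_Mapping.single (x - 1) 1 + n) 1 - f1 \<in> relators l r"
        "Poly_Mapping.single (Poly_Mapping.single x 1 + n) 1 - f2 \<in> relators l r"
        "Poly_Mapping.single (n - Poly_Mapping.single x 1) 1 - f3 \<in> relators l r"
      using IH by meson
    \<comment> \<open>The relator is solved for its heaviest term, and the other three terms are
      replaced by their reductions.\<close>
    define c where "c = hbar * of_nat (Poly_Mapping.lookup n x)"
    define f where "f = const (2 * g) * f2 - f1 - const c * f3"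
    have "relator x (Poly_Mapping.single n 1)
        - (Poly_Mapping.single (Poly_Mapping.single (x - 1) 1 + n) 1 - f1)
        + const (2 * g) * (Poly_Mapping.single (Poly_Mapping.single x 1 + n) 1 - f2)
        - const c * (Poly_Mapping.single (n - Poly_Mapping.single x 1) 1 - f3) \<in> relators l r"
      using x(4) n by (intro relators_diff relators_add relators_scale rel relator_in_relators pol_on_single)
    also have "relator x (Poly_Mapping.single n 1)
        - (Poly_Mapping.single (Poly_Mapping.single (x - 1) 1 + n) 1 - f1)
        + const (2 * g) * (Poly_Mapping.single (Poly_Mapping.single x 1 + n) 1 - f2)
        - const c * (Poly_Mapping.single (n - Poly_Mapping.single x 1) 1 - f3)
        = Poly_Mapping.single m 1 - f"
      unfolding relator_single m f_def by (simp add: c_def right_diff_distrib mult_single)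
    finally show ?thesis
      using f by (intro bexI[of _ f]) (auto simp: f_def intro!: pol_on_diff pol_on_mult)
  qed
qed

lemma reduce:
  assumes "l < r" "P \<in> pol_on {l..r}"
  shows "\<exists>f\<in>pol_on {l, l + 1}. P - f \<in> relators l r"
  using assms(2)
proof (induction rule: pol_on_induct)
  case zero
  show ?case by (intro bexI[of _ 0]) auto
next
  case (add P Q)
  then obtain f h where "f \<in> pol_on {l, l + 1}" "P - f \<in> relators l r"
    "h \<in> pol_on {l, l + 1}" "Q - h \<in> relators l r" by blast
  then show ?case
    using relators_add[of "P - f" l r "Q - h"]
    by (intro bexI[of _ "f + h"]) (auto intro: pol_on_add simp: algebra_simps)
next
  case (single m c)
  then obtain f where "f \<in> pol_on {l, l + 1}" "Poly_Mapping.single m 1 - f \<in> relators l r"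
    using reduce_monomial[OF assms(1)] by blast
  then show ?case
    using relators_scale[of "Poly_Mapping.single m 1 - f" l r c]
    by (intro bexI[of _ "const c * f"]) (auto intro: pol_on_mult simp: right_diff_distrib const_mult_single)
qed


section \<open>A faithful representation of the Weyl algebra\<close>

text \<open>
  The Weyl algebra acts on polynomials such that \<open>hat l\<close> is multiplication by \<open>gen l\<close> and
  \<open>hat (l + 1)\<close> is \<open>raise l\<close>; the action of \<open>q\<close> and \<open>p\<close> follows by inverting the matrix of
  coefficients, whose determinant is \<open>1\<close>.
\<close>

definition raise :: "int \<Rightarrow> 'r pol \<Rightarrow> 'r pol" where
  "raise l P = gen (l + 1) * P + const hbar * pol_partial l P"

definition weyl_op :: "int \<Rightarrow> weyl_gen \<Rightarrow> 'r pol \<Rightarrow> 'r pol" where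
  "weyl_op l x P = (case x of
     Gen_q \<Rightarrow> const (p_coeff (l + 1)) * (gen l * P) - const (p_coeff l) * raise l P
   | Gen_p \<Rightarrow> const (q_coeff l) * raise l P - const (q_coeff (l + 1)) * (gen l * P))"

abbreviation weyl_act :: "int \<Rightarrow> 'r free_alg \<Rightarrow> 'r pol \<Rightarrow> 'r pol" where
  "weyl_act l \<equiv> free_act (weyl_op l)"

lemma linear_pm_raise: "linear_pm (raise l)"
  unfolding raise_def by (intro linear_pm_plus linear_pm_mult_left linear_pm_id linear_pm_pol_partial)

lemma linear_pm_weyl_op: "linear_pm (weyl_op l x)"
  unfolding weyl_op_def
  by (cases x) (simp_all add: linear_pm_diff linear_pm_mult_left linear_pm_id linear_pm_raise)

lemmas linear_pm_weyl_act = linear_pm_free_act[OF linear_pm_weyl_op]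
lemmas weyl_act_mult = free_act_mult[OF linear_pm_weyl_op]

lemma weyl_act_add: "weyl_act l (v + w) P = weyl_act l v P + weyl_act l w P"
  by (rule linear_pm_add[OF linear_pm_free_act1])

lemma weyl_act_diff: "weyl_act l (v - w) P = weyl_act l v P - weyl_act l w P"
  by (rule linear_pm_minus[OF linear_pm_free_act1])

lemma raise_gen_mult: "raise l (gen l * P) = gen l * raise l P + const hbar * P"
  unfolding raise_def by (simp only: pol_partial_gen_mult) (simp add: algebra_simps)

lemma const_det: "const (q_coeff l) * const (p_coeff (l + 1)) - const (q_coeff (l + 1)) * const (p_coeff l) = (1 :: 'r pol)"
  using arg_cong[OF qp_coeff_det[of l], of "const :: 'r \<Rightarrow> 'r pol"] by (simp add: mult_single single_diff)

lemma weyl_act_hat: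
  "weyl_act l (hat l) P = gen l * P"
  "weyl_act l (hat (l + 1)) P = raise l P"
proof -
  have "weyl_act l (hat y) P = const (q_coeff y) * weyl_op l Gen_q P + const (p_coeff y) * weyl_op l Gen_p P" for y
    unfolding hat_def by (simp add: weyl_act_add weyl_act_mult free_act_const)
  then have *: "weyl_act l (hat y) P =
      const (q_coeff y) * (const (p_coeff (l + 1)) * (gen l * P) - const (p_coeff l) * raise l P)
      + const (p_coeff y) * (const (q_coeff l) * raise l P - const (q_coeff (l + 1)) * (gen l * P))" for y
    by (simp only: weyl_op_def weyl_gen.case)
  show "weyl_act l (hat l) P = gen l * P"
  proof -
    have "weyl_act l (hat l) P = (const (q_coeff l) * const (p_coeff (l + 1)) - const (q_coeff (l + 1)) * const (p_coeff l)) * (gen l * P)"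
      by (subst *) (simp only: algebra_simps)
    then show ?thesis by (simp only: const_det mult_1)
  qed
  show "weyl_act l (hat (l + 1)) P = raise l P"
  proof -
    have "weyl_act l (hat (l + 1)) P = (const (q_coeff l) * const (p_coeff (l + 1)) - const (q_coeff (l + 1)) * const (p_coeff l)) * raise l P"
      by (subst *) (simp only: algebra_simps)
    then show ?thesis by (simp only: const_det mult_1)
  qed
qed

text \<open>By bilinearity this is the Wronskian, which is 1, times the commutator of
  \<open>raise l\<close> with multiplication by \<open>gen l\<close>.\<close>

lemma weyl_op_commutator:
  "weyl_op l Gen_p (weyl_op l Gen_q P) - weyl_op l Gen_q (weyl_op l Gen_p P) = const hbar * P"
proof -
  define s t s' t' :: "'r pol" where st:
    "s = const (q_coeff l)" "t = const (p_coeff l)" "s' = const (q_coeff (l + 1))" "t' = const (p_coeff (l + 1))"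
  have sc: "raise l (s * Q) = s * raise l Q" "raise l (t * Q) = t * raise l Q"
    "raise l (s' * Q) = s' * raise l Q" "raise l (t' * Q) = t' * raise l Q" for Q
    by (simp_all add: st linear_pm_scale[OF linear_pm_raise])
  have "weyl_op l Gen_p (weyl_op l Gen_q P) - weyl_op l Gen_q (weyl_op l Gen_p P) =
      (s * t' - s' * t) * (raise l (gen l * P) - gen l * raise l P)"
    unfolding weyl_op_def weyl_gen.case linear_pm_minus[OF linear_pm_raise] st[symmetric] sc
    by (simp only: algebra_simps)
  also have "s * t' - s' * t = 1"
    unfolding st by (rule const_det)
  finally show ?thesis by (simp only: raise_gen_mult mult_1 add_diff_cancel_left')
qed

text \<open>The elements acting as 0 form a two-sided ideal containing the defining
  relation.\<close>

lemma weyl_act_cong: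
  assumes "weyl_cong hbar v w"
  shows "weyl_act l v P = weyl_act l w P"
proof -
  have "weyl_ideal hbar \<subseteq> {u. \<forall>P. weyl_act l u P = 0}"
  proof (rule weyl_ideal_minimal)
    show "free_p * free_q - free_q * free_p - const hbar \<in> {u. \<forall>P. weyl_act l u P = 0}"
      by (simp add: weyl_act_diff weyl_act_mult weyl_op_commutator free_act_const)
  qed (simp_all add: weyl_act_add weyl_act_mult linear_pm_zero[OF linear_pm_free_act1] linear_pm_zero[OF linear_pm_weyl_act])
  then have "weyl_act l (v - w) P = 0" using assms by (auto simp: weyl_cong_def)
  then show ?thesis by (simp add: weyl_act_diff)
qed

lemma hat_mon_adjacent:
  assumes "Poly_Mapping.keys m \<subseteq> {l, l + 1}"
  shows "hat_mon m = hat l ^ Poly_Mapping.lookup m l * hat (l + 1) ^ Poly_Mapping.lookup m (l + 1)"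
proof -
  have "Poly_Mapping.keys m \<subseteq> {l..l + 1}" using assms by auto
  from hat_mon_upto[OF this] show ?thesis
    by (simp add: upto_rec1[of l] upto_rec1[of "l + 1"])
qed

lemma time_ordered_gen_mult_adjacent:
  assumes "P \<in> pol_on {l, l + 1}"
  shows "time_ordered (gen l * P) = hat l * time_ordered P"
proof (rule linear_pm_eq_on[of "\<lambda>P. time_ordered (gen l * P)" "\<lambda>P. hat l * time_ordered P"
      P "{m. Poly_Mapping.keys m \<subseteq> {l, l + 1}}"])
  fix m :: "int \<Rightarrow>\<^sub>0 nat" assume m: "m \<in> {m. Poly_Mapping.keys m \<subseteq> {l, l + 1}}"
  then have "Poly_Mapping.keys (Poly_Mapping.single l 1 + m) \<subseteq> {l, l + 1}"
    by (auto simp: keys_add_nat)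
  from hat_mon_adjacent[OF this] m
  show "time_ordered (gen l * Poly_Mapping.single m 1) = hat l * time_ordered (Poly_Mapping.single m 1)"
    by (simp add: mult_single time_ordered_single hat_mon_adjacent lookup_add lookup_single mult.assoc)
next
  show "linear_pm (\<lambda>P. time_ordered (gen l * P))"
    by (rule linear_pm_comp[OF linear_pm_time_ordered linear_pm_mult_left[OF linear_pm_id]])
qed (use assms in \<open>auto simp: pol_on_def intro: linear_pm_mult_left linear_pm_time_ordered\<close>)

text \<open>To restore the order, \<open>hat (l + 1)\<close> has to pass the power of
  \<open>hat l\<close> in front; the correction is exactly the derivative term in
  \<open>raise\<close>.\<close>

lemma time_ordered_raise:
  assumes "P \<in> pol_on {l, l + 1}"
  shows "weyl_cong hbar (time_ordered (raise l P)) (hat (l + 1) * time_ordered P)"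
  using assms
proof (induction rule: pol_on_induct)
  case zero
  then show ?case by (simp add: linear_pm_zero linear_pm_raise linear_pm_time_ordered)
next
  case (add P Q)
  then show ?case
    using weyl_cong_add[OF add]
    by (simp add: linear_pm_add[OF linear_pm_raise] linear_pm_add[OF linear_pm_time_ordered] distrib_left)
next
  case (single m c)
  define i j where ij: "i = Poly_Mapping.lookup m l" "j = Poly_Mapping.lookup m (l + 1)"
  have k: "Poly_Mapping.keys (Poly_Mapping.single (l + 1) 1 + m) \<subseteq> {l, l + 1}"
    "Poly_Mapping.keys (m - Poly_Mapping.single l 1) \<subseteq> {l, l + 1}"
    using single keys_minus_nat[of m "Poly_Mapping.single l 1"] by (auto simp: keys_add_nat)
  have "time_ordered (raise l (Poly_Mapping.single m 1)) =
      (hat l ^ i * hat (l + 1) + of_nat i * const hbar * hat l ^ (i - 1)) * hat (l + 1) ^ j"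
  proof -
    have "const (hbar * of_nat i) = of_nat i * (const hbar :: 'r free_alg)"
      by (simp add: mult_single mult.commute flip: single_of_nat)
    then show ?thesis
      unfolding raise_def
      by (simp add: mult_single pol_partial_single linear_pm_add[OF linear_pm_time_ordered]
        time_ordered_single hat_mon_adjacent[OF k(1), simplified] hat_mon_adjacent[OF k(2), simplified]
        lookup_add lookup_minus lookup_single distrib_right mult.assoc flip: ij)
  qed
  also have "weyl_cong hbar \<dots> (hat (l + 1) * hat l ^ i * hat (l + 1) ^ j)"
    by (intro weyl_cong_mult_right weyl_cong_sym[OF hat_commute_power])
  also have "\<dots> = hat (l + 1) * time_ordered (Poly_Mapping.single m 1)"
    by (simp add: time_ordered_single hat_mon_adjacent[OF single] ij mult.assoc)
  finally have *: "weyl_cong hbar (time_ordered (raise l (Poly_Mapping.single m 1))) (hat (l + 1) * time_ordered (Poly_Mapping.single m 1))" .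
  show ?case
    using weyl_cong_mult_left[OF *, of "const c"]
      linear_pm_single[OF linear_pm_comp[OF linear_pm_time_ordered linear_pm_raise, of l], of m c]
      linear_pm_single[OF linear_pm_mult_left[OF linear_pm_time_ordered], of "hat (l + 1)" m c]
    by simp
qed

lemma lin_comb_hat:
  "free_q = const (p_coeff (l + 1)) * hat l - const (p_coeff l) * hat (l + 1)"
  "free_p = const (q_coeff l) * hat (l + 1) - const (q_coeff (l + 1)) * hat l"
proof -
  note det = qp_coeff_det[of l]
  have "const (p_coeff (l + 1)) * hat l - const (p_coeff l) * hat (l + 1) =
      lin_qp (p_coeff (l + 1) * q_coeff l - p_coeff l * q_coeff (l + 1)) (p_coeff (l + 1) * p_coeff l - p_coeff l * p_coeff (l + 1))"
    using lin_qp_comb[of "p_coeff (l + 1)" "q_coeff l" "p_coeff l" "- p_coeff l" "q_coeff (l + 1)" "p_coeff (l + 1)"]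
    by (simp add: hat_def single_uminus)
  also have "\<dots> = lin_qp 1 0"
    by (rule arg_cong2[where f = lin_qp]) (use det in \<open>simp_all add: algebra_simps\<close>)
  finally show "free_q = const (p_coeff (l + 1)) * hat l - const (p_coeff l) * hat (l + 1)" by simp
  have "const (q_coeff l) * hat (l + 1) - const (q_coeff (l + 1)) * hat l =
      lin_qp (q_coeff l * q_coeff (l + 1) - q_coeff (l + 1) * q_coeff l) (q_coeff l * p_coeff (l + 1) - q_coeff (l + 1) * p_coeff l)"
    using lin_qp_comb[of "q_coeff l" "q_coeff (l + 1)" "p_coeff (l + 1)" "- q_coeff (l + 1)" "q_coeff l" "p_coeff l"]
    by (simp add: hat_def single_uminus)
  also have "\<dots> = lin_qp 0 1"
    by (rule arg_cong2[where f = lin_qp]) (use det in \<open>simp_all add: algebra_simps\<close>)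
  finally show "free_p = const (q_coeff l) * hat (l + 1) - const (q_coeff (l + 1)) * hat l" by simp
qed

lemma pol_on_weyl_op: "P \<in> pol_on {l, l + 1} \<Longrightarrow> weyl_op l x P \<in> pol_on {l, l + 1}"
  unfolding weyl_op_def raise_def
  by (cases x) (auto intro!: pol_on_diff pol_on_add pol_on_mult pol_on_pol_partial simp: pol_on_single)

lemma time_ordered_weyl_op:
  assumes "P \<in> pol_on {l, l + 1}"
  shows "weyl_cong hbar (time_ordered (weyl_op l Gen_q P)) (free_q * time_ordered P)"
    and "weyl_cong hbar (time_ordered (weyl_op l Gen_p P)) (free_p * time_ordered P)"
proof -
  let ?T = time_ordered
  have eq: "?T (const c * A - const d * B) = const c * ?T A - const d * ?T B" for c d A B
    by (simp add: linear_pm_minus[OF linear_pm_time_ordered] linear_pm_scale[OF linear_pm_time_ordered])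
  have "weyl_cong hbar (?T (weyl_op l Gen_q P))
      (const (p_coeff (l + 1)) * (hat l * ?T P) - const (p_coeff l) * (hat (l + 1) * ?T P))"
    unfolding weyl_op_def weyl_gen.case eq time_ordered_gen_mult_adjacent[OF assms]
    by (intro weyl_cong_diff weyl_cong_mult_left weyl_cong_refl time_ordered_raise assms)
  also have "\<dots> = free_q * ?T P"
    unfolding lin_comb_hat[of l] by (simp add: left_diff_distrib mult.assoc)
  finally show "weyl_cong hbar (?T (weyl_op l Gen_q P)) (free_q * ?T P)" .
  have "weyl_cong hbar (?T (weyl_op l Gen_p P))
      (const (q_coeff l) * (hat (l + 1) * ?T P) - const (q_coeff (l + 1)) * (hat l * ?T P))"
    unfolding weyl_op_def weyl_gen.case eq time_ordered_gen_mult_adjacent[OF assms]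
    by (intro weyl_cong_diff weyl_cong_mult_left weyl_cong_refl time_ordered_raise assms)
  also have "\<dots> = free_p * ?T P"
    unfolding lin_comb_hat[of l] by (simp add: left_diff_distrib mult.assoc)
  finally show "weyl_cong hbar (?T (weyl_op l Gen_p P)) (free_p * ?T P)" .
qed

text \<open>Normal ordering: modulo the ideal, \<open>time_ordered\<close> intertwines
  \<open>weyl_op\<close> with left multiplication by q and p, so the result of acting on 1 is a
  preimage of \<open>w\<close>.\<close>

lemma time_ordered_weyl_act:
  "weyl_act l w 1 \<in> pol_on {l, l + 1} \<and> weyl_cong hbar (time_ordered (weyl_act l w 1)) w"
proof (induction w rule: free_alg_induct)
  case (const c)
  show ?case by (simp add: free_act_const time_ordered_const)
next
  case (q w)
  then have "weyl_cong hbar (time_ordered (weyl_op l Gen_q (weyl_act l w 1))) (free_q * w)"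
    by (meson time_ordered_weyl_op weyl_cong_mult_left weyl_cong_trans)
  with q show ?case by (simp add: weyl_act_mult pol_on_weyl_op)
next
  case (p w)
  then have "weyl_cong hbar (time_ordered (weyl_op l Gen_p (weyl_act l w 1))) (free_p * w)"
    by (meson time_ordered_weyl_op weyl_cong_mult_left weyl_cong_trans)
  with p show ?case by (simp add: weyl_act_mult pol_on_weyl_op)
next
  case (add v w)
  then show ?case
    by (simp add: weyl_act_add pol_on_add weyl_cong_add linear_pm_add[OF linear_pm_time_ordered])
qed

text \<open>The powers of \<open>hat (l + 1)\<close> act first, on polynomials without
  \<open>gen l\<close>, where the derivative in \<open>raise\<close> vanishes. The powers of
  \<open>hat l\<close> then only multiply, so the monomial itself comes back.\<close>

lemma weyl_act_time_ordered:
  assumes "P \<in> pol_on {l, l + 1}"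
  shows "weyl_act l (time_ordered P) 1 = P"
proof (rule linear_pm_eq_on[of "\<lambda>P. weyl_act l (time_ordered P) 1" "\<lambda>P. P" P "{m. Poly_Mapping.keys m \<subseteq> {l, l + 1}}"])
  fix m :: "int \<Rightarrow>\<^sub>0 nat" assume "m \<in> {m. Poly_Mapping.keys m \<subseteq> {l, l + 1}}"
  then have m: "Poly_Mapping.keys m \<subseteq> {l, l + 1}" by simp
  have v: "weyl_act l (hat (l + 1) ^ j) 1 = Poly_Mapping.single (Poly_Mapping.single (l + 1) j) 1" for j
  proof (induction j)
    case (Suc j)
    show ?case
      by (simp add: weyl_act_mult Suc weyl_act_hat raise_def mult_single pol_partial_single lookup_single flip: single_add)
  qed simp
  have u: "weyl_act l (hat l ^ i) (Poly_Mapping.single n 1) = Poly_Mapping.single (Poly_Mapping.single l i + n) 1" for i n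
  proof (induction i)
    case (Suc i)
    show ?case
      by (simp add: weyl_act_mult Suc weyl_act_hat mult_single flip: single_add add.assoc)
  qed simp
  have "m = Poly_Mapping.single l (Poly_Mapping.lookup m l) + Poly_Mapping.single (l + 1) (Poly_Mapping.lookup m (l + 1))"
    using m by (intro poly_mapping_eqI) (auto simp: lookup_add lookup_single when_def in_keys_iff subset_iff)
  then show "weyl_act l (time_ordered (Poly_Mapping.single m 1)) 1 = Poly_Mapping.single m 1"
    by (simp add: time_ordered_single hat_mon_adjacent[OF m] weyl_act_mult u v)
qed (use assms in \<open>auto simp: pol_on_def intro: linear_pm_comp[OF linear_pm_free_act1 linear_pm_time_ordered]\<close>)

theorem time_ordered_surj: "\<exists>P\<in>pol_on {l, l + 1}. weyl_cong hbar (time_ordered P) w"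
  using time_ordered_weyl_act by blast

text \<open>Subtracting a coboundary leaves a polynomial f in two generators with value 0; the
  representation reads f off from that value, so f = 0.\<close>

theorem time_ordered_inj:
  assumes "l < r" "P \<in> pol_on {l..r}" "weyl_cong hbar (time_ordered P) 0"
  shows "P \<in> relators l r"
proof -
  obtain f where f: "f \<in> pol_on {l, l + 1}" "P - f \<in> relators l r"
    using reduce[OF assms(1,2)] by blast
  have "weyl_cong hbar (time_ordered P - time_ordered (P - f)) (0 - 0)"
    by (intro weyl_cong_diff assms time_ordered_relators[OF f(2)])
  then have "weyl_act l (time_ordered f) 1 = weyl_act l 0 1"
    by (intro weyl_act_cong) (simp add: linear_pm_minus[OF linear_pm_time_ordered])
  then have "f = 0"
    using f(1) by (simp add: weyl_act_time_ordered linear_pm_zero[OF linear_pm_free_act1])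
  then show ?thesis using f(2) by simp
qed

end


section \<open>The complexes in degrees zero and minus one\<close>

abbreviation emb :: "'r::comm_ring_1 pol \<Rightarrow> 'r sym" where
  "emb \<equiv> Poly_Mapping.single {||}"

lemma emb_sum: "(\<Sum>i\<in>A. emb (f i)) = emb (\<Sum>i\<in>A. f i)"
  by (induction A rule: infinite_finite_induct) (simp_all add: single_add)

lemma emb_eq_iff [simp]: "emb P = emb Q \<longleftrightarrow> P = Q"
  by (metis lookup_single_eq)

lemma smul_emb: "emb P \<cdot>\<^sub>s emb Q = emb (P * Q)"
  by (cases "P = 0"; cases "Q = 0") (simp_all add: smul_def shuffle_sign_def)

lemma scalar_smul_emb: "scalar c \<cdot>\<^sub>s emb P = emb (const c * P)"
  by (simp add: scalar_def smul_emb)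

lemma lin_superset:
  assumes "finite A" "{x. h x \<noteq> 0} \<subseteq> A"
  shows "lin h = emb (\<Sum>x\<in>A. const (h x) * gen x)"
proof -
  have "(\<Sum>x | h x \<noteq> 0. Poly_Mapping.single (Poly_Mapping.single x 1) (h x)) = (\<Sum>x\<in>A. const (h x) * gen x)"
    using assms by (intro sum.mono_neutral_cong_left) (auto simp: const_mult_single)
  then show ?thesis by (simp only: lin_def)
qed

lemma lin_delta: "lin (delta x) = emb (gen x)"
  by (subst lin_superset[of "{x}"]) (auto simp: delta_def)

lemma lin_Q_op_delta:
  "lin (Q_op \<kappa> \<alpha> (delta x)) =
     emb (gen (x - 1) - const (\<kappa> (\<alpha> + inverse \<alpha>)) * gen x + gen (x + 1))"
  by (subst lin_superset[of "{x - 1, x, x + 1}"]) (auto simp: Q_op_def delta_def single_uminus)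

lemma sites_eq: "sites a b = {\<lfloor>a\<rfloor> + 1..\<lceil>b\<rceil> - 1}"
  unfolding sites_def by (auto; linarith)

lemma interior_sites_eq: "sites (a + 1) (b - 1) = {\<lfloor>a\<rfloor> + 1<..<\<lceil>b\<rceil> - 1}"
  unfolding sites_def by (auto; linarith)

text \<open>Here the length condition enters: it guarantees two adjacent sites, as many as there are
  generators of the Weyl algebra.\<close>

lemma sites_nonempty_interval: "b - a > 2 \<Longrightarrow> \<lfloor>a\<rfloor> + 1 < \<lceil>b\<rceil> - 1" for a b :: real
  by linarith

lemma Sym_deg_0: "Sym_deg a b 0 = emb ` pol_on (sites a b)"
proof (intro equalityI subsetI)
  fix f :: "'a sym" assume "f \<in> Sym_deg a b 0"
  then have f: "f \<in> Sym a b" "\<And>S. S \<in> Poly_Mapping.keys f \<Longrightarrow> S = {||}"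
    by (auto simp: Sym_deg_def)
  define P where "P = Poly_Mapping.lookup f {||}"
  have "f = emb P"
  proof (rule poly_mapping_eqI)
    fix S
    show "Poly_Mapping.lookup f S = Poly_Mapping.lookup (emb P) S"
      using f(2)[of S] by (cases "S = {||}") (auto simp: P_def lookup_single in_keys_iff)
  qed
  moreover from this have "P \<in> pol_on (sites a b)"
    using f(1) by (cases "P = 0") (auto simp: Sym_def pol_on_def)
  ultimately show "f \<in> emb ` pol_on (sites a b)" by blast
qed (auto simp: Sym_deg_def Sym_def pol_on_def split: if_splits)

lemma odd_partial_deg_0: "Poly_Mapping.keys f \<subseteq> {{||}} \<Longrightarrow> odd_partial x f = 0"
  unfolding odd_partial_def by (rule sum.neutral) auto

lemma d_quantum_emb: "d_quantum \<kappa> hbar \<alpha> a b (emb P) = 0"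
proof -
  have "Poly_Mapping.keys (even_partial x (emb P)) \<subseteq> {{||}}" for x
    by (cases "P = 0") (simp_all add: even_partial_def)
  moreover have "Poly_Mapping.keys (emb P) \<subseteq> {{||}}" by simp
  ultimately show ?thesis
    by (simp add: d_quantum_def d_classical_def BV_laplacian_def odd_partial_deg_0 smul_def)
qed

lemma cocycles0_eq: "cocycles0 \<kappa> hbar \<alpha> a b = emb ` pol_on (sites a b)"
  unfolding cocycles0_def Sym_deg_0 by (auto simp: d_quantum_emb)

text \<open>In degree -1 each odd monomial is a single generator; nothing stands to its left, so the
  sign is 1.\<close>

lemma odd_partial_deg_1:
  assumes "\<And>S. S \<in> Poly_Mapping.keys f \<Longrightarrow> fcard S = 1"
  shows "odd_partial x f = emb (Poly_Mapping.lookup f {|x|})"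
proof -
  have "x |\<in>| S \<longleftrightarrow> S = {|x|}" if S: "S \<in> Poly_Mapping.keys f" for S
  proof -
    obtain y where "fset S = {y}"
      using assms[OF S] by (auto simp: fcard.rep_eq card_1_singleton_iff)
    then show ?thesis by (metis bot_fset.rep_eq finsert.rep_eq fset_inject singleton_iff)
  qed
  then have "{S \<in> Poly_Mapping.keys f. x |\<in>| S} = (if {|x|} \<in> Poly_Mapping.keys f then {{|x|}} else {})"
    by auto
  then show ?thesis
    by (simp add: odd_partial_def in_keys_iff cong: conj_cong)
qed

lemma lookup_even_partial:
  "Poly_Mapping.lookup (even_partial x f) S = pol_partial x (Poly_Mapping.lookup f S)"
  by (simp add: even_partial_def lookup_sum lookup_single when_def in_keys_iff
      linear_pm_zero[OF linear_pm_pol_partial])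

lemma d_quantum_deg_1:
  assumes "\<And>S. S \<in> Poly_Mapping.keys f \<Longrightarrow> fcard S = 1"
  shows "d_quantum \<kappa> hbar \<alpha> a b f = emb (\<Sum>x\<in>sites (a + 1) (b - 1).
    (gen (x - 1) - const (\<kappa> (\<alpha> + inverse \<alpha>)) * gen x + gen (x + 1)) * Poly_Mapping.lookup f {|x|}
    + const hbar * pol_partial x (Poly_Mapping.lookup f {|x|}))"
proof -
  have "fcard S = 1" if "S \<in> Poly_Mapping.keys (even_partial x f)" for x S
    using that assms[of S] by (cases "Poly_Mapping.lookup f S = 0")
      (auto simp: in_keys_iff lookup_even_partial linear_pm_zero[OF linear_pm_pol_partial])
  then have "odd_partial x (even_partial x f) = emb (pol_partial x (Poly_Mapping.lookup f {|x|}))" for x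
    using odd_partial_deg_1[of "even_partial x f" x] by (simp add: lookup_even_partial)
  moreover have "lin (Q_op \<kappa> \<alpha> (delta x)) \<cdot>\<^sub>s odd_partial x f =
      emb ((gen (x - 1) - const (\<kappa> (\<alpha> + inverse \<alpha>)) * gen x + gen (x + 1)) * Poly_Mapping.lookup f {|x|})" for x
    by (simp only: odd_partial_deg_1[OF assms] lin_Q_op_delta smul_emb)
  ultimately show ?thesis
    unfolding d_quantum_def d_classical_def BV_laplacian_def
    by (simp only: emb_sum scalar_smul_emb sum_distrib_left sum.distrib single_add)
qed

text \<open>
  With \<open>g = (\<alpha> + \<alpha>\<inverse>) / 2\<close> the entries of the translation matrix are \<open>g\<close>, \<open>1\<close> and
  \<open>g\<^sup>2 - 1 = ((\<alpha> - \<alpha>\<inverse>) / 2)\<^sup>2\<close>.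
\<close>

locale observables = oscillator g hbar
  for g hbar :: "'r::comm_ring_1" +
  fixes \<kappa> :: "'k::field_char_0 \<Rightarrow> 'r" and \<alpha> :: 'k
  assumes hom: "unital_ring_hom \<kappa>"
    and \<alpha>_nonzero: "\<alpha> \<noteq> 0"
    and g_eq: "g = \<kappa> ((\<alpha> + inverse \<alpha>) / 2)"
begin

lemma \<kappa>_simps:
  "\<kappa> 1 = 1" "\<kappa> (x + y) = \<kappa> x + \<kappa> y" "\<kappa> (x * y) = \<kappa> x * \<kappa> y"
  using hom by (auto simp: unital_ring_hom_def)

lemma \<kappa>_diff: "\<kappa> (x - y) = \<kappa> x - \<kappa> y"
  using \<kappa>_simps(2)[of "x - y" y] by simp

lemma \<kappa>_half: "\<kappa> (1 / 2) + \<kappa> (1 / 2) = 1"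
  by (simp flip: \<kappa>_simps(1,2))

lemma \<kappa>_trace: "\<kappa> (\<alpha> + inverse \<alpha>) = 2 * g"
  using \<kappa>_simps(2)[of "(\<alpha> + inverse \<alpha>) / 2" "(\<alpha> + inverse \<alpha>) / 2"] unfolding g_eq by simp

lemma \<kappa>_discriminant: "\<kappa> (((\<alpha> - inverse \<alpha>) / 2)\<^sup>2) = g\<^sup>2 - 1"
proof -
  have "((\<alpha> - inverse \<alpha>) / 2)\<^sup>2 = ((\<alpha> + inverse \<alpha>) / 2) * ((\<alpha> + inverse \<alpha>) / 2) - 1"
    using \<alpha>_nonzero by (simp add: field_simps power2_eq_square)
  then show ?thesis
    by (simp only: \<kappa>_diff \<kappa>_simps(1,3) g_eq power2_eq_square)
qed

lemma coboundaries0_eq: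
  "coboundaries0 \<kappa> hbar \<alpha> a b = emb ` relators (\<lfloor>a\<rfloor> + 1) (\<lceil>b\<rceil> - 1)"
proof -
  define l r where lr: "l = \<lfloor>a\<rfloor> + 1" "r = \<lceil>b\<rceil> - 1"
  note sites = sites_eq[of a b] interior_sites_eq[of a b]
  have d: "d_quantum \<kappa> hbar \<alpha> a b f = emb (\<Sum>x\<in>{l<..<r}. relator x (Poly_Mapping.lookup f {|x|}))"
    if "f \<in> Sym_deg a b (- 1)" for f
    using that by (subst d_quantum_deg_1) (auto simp: Sym_deg_def sites relator_def \<kappa>_trace lr)
  have lookup: "Poly_Mapping.lookup f {|x|} \<in> pol_on {l..r}" if "f \<in> Sym_deg a b (- 1)" for f :: "'r sym" and x
  proof (cases "{|x|} \<in> Poly_Mapping.keys f")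
    case True
    then show ?thesis using that unfolding Sym_deg_def Sym_def pol_on_def sites lr by blast
  qed (simp add: in_keys_iff)
  have "emb (\<Sum>x\<in>{l<..<r}. relator x (P x)) \<in> coboundaries0 \<kappa> hbar \<alpha> a b"
    if P: "\<forall>x\<in>{l<..<r}. P x \<in> pol_on {l..r}" for P
  proof -
    define f where "f = (\<Sum>x\<in>{l<..<r}. Poly_Mapping.single {|x|} (P x))"
    have lf: "Poly_Mapping.lookup f S = (\<Sum>x\<in>{l<..<r}. if {|x|} = S then P x else 0)" for S
      by (simp add: f_def lookup_sum lookup_single when_def)
    have lfx: "Poly_Mapping.lookup f {|x|} = P x" if "x \<in> {l<..<r}" for x
      unfolding lf using that by (simp add: sum.delta)
    have keys: "\<exists>x\<in>{l<..<r}. S = {|x|}" if "S \<in> Poly_Mapping.keys f" for S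
    proof (rule ccontr)
      assume "\<not> ?thesis"
      then have "Poly_Mapping.lookup f S = 0" unfolding lf by (intro sum.neutral) auto
      then show False using that by auto
    qed
    have "f \<in> Sym_deg a b (- 1)"
      unfolding Sym_deg_def Sym_def mem_Collect_eq
    proof (intro conjI ballI)
      fix S assume "S \<in> Poly_Mapping.keys f"
      then obtain x where x: "x \<in> {l<..<r}" "S = {|x|}" using keys by blast
      show "fset S \<subseteq> sites (a + 1) (b - 1)" using x by (simp add: sites lr)
      show "- int (fcard S) = - 1" by (simp add: x fcard.rep_eq)
      fix m assume "m \<in> Poly_Mapping.keys (Poly_Mapping.lookup f S)"
      moreover have "P x \<in> pol_on (sites a b)"
        using P x(1) by (simp add: sites lr)
      ultimately show "Poly_Mapping.keys m \<subseteq> sites a b"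
        using x lfx[OF x(1)] by (auto simp: pol_on_def)
    qed
    then show ?thesis
      unfolding coboundaries0_def by (intro image_eqI[of _ _ f]) (simp_all add: d lfx)
  qed
  then show ?thesis
    unfolding lr[symmetric] by (auto simp: coboundaries0_def relators_def d intro!: imageI exI lookup)
qed

section \<open>Cohomology classes as fibres of the time-ordered map\<close>

definition obs_class :: "real \<Rightarrow> real \<Rightarrow> 'r free_alg \<Rightarrow> 'r sym set" where
  "obs_class a b w = emb ` {P \<in> pol_on (sites a b). weyl_cong hbar (time_ordered P) w}"

text \<open>A coset lies in one fibre because coboundaries have value 0; it fills the fibre by
  \<open>time_ordered_inj\<close>.\<close>

lemma coh_class_emb:
  assumes "b - a > 2" "P \<in> pol_on (sites a b)"
  shows "coh_class \<kappa> hbar \<alpha> a b (emb P) = obs_class a b (time_ordered P)"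
proof -
  define l r where lr: "l = \<lfloor>a\<rfloor> + 1" "r = \<lceil>b\<rceil> - 1"
  have s: "sites a b = {l..r}" and lt: "l < r"
    using sites_nonempty_interval[OF assms(1)] by (simp_all add: sites_eq lr)
  have "coh_class \<kappa> hbar \<alpha> a b (emb P) = emb ` ((+) P ` relators l r)"
    unfolding coh_class_def coboundaries0_eq lr by (simp add: image_image single_add)
  also have "(+) P ` relators l r = {Q \<in> pol_on {l..r}. weyl_cong hbar (time_ordered Q) (time_ordered P)}"
  proof (intro equalityI subsetI)
    fix Q assume "Q \<in> (+) P ` relators l r"
    then obtain R where R: "R \<in> relators l r" "Q = P + R" by blast
    have "R \<in> pol_on {l..r}"
      using R(1) unfolding relators_def by (auto intro: pol_on_sum pol_on_relator)
    moreover have "weyl_cong hbar (time_ordered P + time_ordered R) (time_ordered P + 0)"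
      by (intro weyl_cong_add weyl_cong_refl time_ordered_relators[OF R(1)])
    ultimately show "Q \<in> {Q \<in> pol_on {l..r}. weyl_cong hbar (time_ordered Q) (time_ordered P)}"
      using assms(2) by (simp add: R(2) s pol_on_add linear_pm_add[OF linear_pm_time_ordered])
  next
    fix Q assume Q: "Q \<in> {Q \<in> pol_on {l..r}. weyl_cong hbar (time_ordered Q) (time_ordered P)}"
    then have "Q - P \<in> relators l r"
      using assms(2) by (intro time_ordered_inj[OF lt])
        (auto simp: s pol_on_diff linear_pm_minus[OF linear_pm_time_ordered] weyl_cong_def)
    then show "Q \<in> (+) P ` relators l r"
      by (intro image_eqI[of _ _ "Q - P"]) auto
  qed
  finally show ?thesis by (simp add: obs_class_def s)
qed

lemma obs_class_witness:
  assumes "b - a > 2"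
  obtains P where "P \<in> pol_on (sites a b)" "weyl_cong hbar (time_ordered P) w"
proof -
  define l where "l = \<lfloor>a\<rfloor> + 1"
  obtain P where P: "P \<in> pol_on {l, l + 1}" "weyl_cong hbar (time_ordered P) w"
    using time_ordered_surj by blast
  have "{l, l + 1} \<subseteq> sites a b"
    using sites_nonempty_interval[OF assms] by (simp add: sites_eq l_def)
  with P that show ?thesis by (meson pol_on_mono)
qed

lemma obs_class_cong: "weyl_cong hbar v w \<Longrightarrow> obs_class a b v = obs_class a b w"
proof -
  assume "weyl_cong hbar v w"
  then have "weyl_cong hbar u v \<longleftrightarrow> weyl_cong hbar u w" for u
    by (blast intro: weyl_cong_trans weyl_cong_sym)
  then show ?thesis by (simp add: obs_class_def)
qed

lemma emb_in_obs_class: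
  "emb P \<in> obs_class a b w \<longleftrightarrow> P \<in> pol_on (sites a b) \<and> weyl_cong hbar (time_ordered P) w"
  by (auto simp: obs_class_def)

lemma obs_class_nonempty:
  assumes "b - a > 2"
  shows "obs_class a b w \<noteq> {}"
proof -
  obtain P where "P \<in> pol_on (sites a b)" "weyl_cong hbar (time_ordered P) w"
    using obs_class_witness[OF assms] by blast
  then have "emb P \<in> obs_class a b w" by (simp add: emb_in_obs_class)
  then show ?thesis by blast
qed

lemma obs_class_eq_iff:
  assumes "b - a > 2"
  shows "obs_class a b v = obs_class a b w \<longleftrightarrow> weyl_cong hbar v w"
proof
  assume eq: "obs_class a b v = obs_class a b w"
  obtain P where "P \<in> pol_on (sites a b)" "weyl_cong hbar (time_ordered P) v"
    using obs_class_witness[OF assms] by blast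
  moreover from this have "emb P \<in> obs_class a b w"
    by (simp add: emb_in_obs_class flip: eq)
  ultimately show "weyl_cong hbar v w"
    by (auto simp: emb_in_obs_class intro: weyl_cong_trans weyl_cong_sym)
qed (rule obs_class_cong)

lemma H0_eq:
  assumes "b - a > 2"
  shows "H0 \<kappa> hbar \<alpha> a b = range (obs_class a b)"
proof (intro equalityI subsetI)
  fix U assume "U \<in> H0 \<kappa> hbar \<alpha> a b"
  then show "U \<in> range (obs_class a b)"
    unfolding H0_def cocycles0_eq by (auto simp: coh_class_emb[OF assms])
next
  fix U assume "U \<in> range (obs_class a b)"
  then obtain w where U: "U = obs_class a b w" by blast
  obtain P where P: "P \<in> pol_on (sites a b)" "weyl_cong hbar (time_ordered P) w"
    using obs_class_witness[OF assms] by blast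
  have "U = coh_class \<kappa> hbar \<alpha> a b (emb P)"
    using P by (simp add: U coh_class_emb[OF assms] obs_class_cong)
  then show "U \<in> H0 \<kappa> hbar \<alpha> a b"
    unfolding H0_def cocycles0_eq using P by blast
qed

text \<open>All representatives are sent into one class and there is at least one representative, so
  the union in \<open>induced\<close> is that class.\<close>

lemma induced_obs_class:
  assumes "b - a > 2" "d - c > 2"
    and "\<And>P. P \<in> pol_on (sites a b) \<Longrightarrow> weyl_cong hbar (time_ordered P) w \<Longrightarrow>
      \<exists>Q\<in>pol_on (sites c d). F (emb P) = emb Q \<and> weyl_cong hbar (time_ordered Q) w'"
  shows "induced \<kappa> hbar \<alpha> c d F (obs_class a b w) = obs_class c d w'"
proof -
  have "coh_class \<kappa> hbar \<alpha> c d (F f) = obs_class c d w'" if f: "f \<in> obs_class a b w" for f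
  proof -
    obtain P where P: "P \<in> pol_on (sites a b)" "weyl_cong hbar (time_ordered P) w" "f = emb P"
      using f by (auto simp: obs_class_def)
    from assms(3)[OF P(1,2)] show ?thesis
      by (auto simp: P(3) coh_class_emb[OF assms(2)] obs_class_cong)
  qed
  moreover have "obs_class a b w \<noteq> {}"
    by (rule obs_class_nonempty[OF assms(1)])
  ultimately show ?thesis unfolding induced_def by simp
qed

lemma induced2_obs_class:
  assumes "b1 - a1 > 2" "b2 - a2 > 2" "d - c > 2"
    and "\<And>P Q. P \<in> pol_on (sites a1 b1) \<Longrightarrow> Q \<in> pol_on (sites a2 b2) \<Longrightarrow>
      weyl_cong hbar (time_ordered P) v \<Longrightarrow> weyl_cong hbar (time_ordered Q) w \<Longrightarrow>
      \<exists>R\<in>pol_on (sites c d). F (emb P) (emb Q) = emb R \<and> weyl_cong hbar (time_ordered R) u"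
  shows "induced2 \<kappa> hbar \<alpha> c d F (obs_class a1 b1 v) (obs_class a2 b2 w) = obs_class c d u"
proof -
  have "coh_class \<kappa> hbar \<alpha> c d (F f h) = obs_class c d u"
    if fh: "f \<in> obs_class a1 b1 v" "h \<in> obs_class a2 b2 w" for f h
  proof -
    obtain P Q where P: "P \<in> pol_on (sites a1 b1)" "weyl_cong hbar (time_ordered P) v" "f = emb P"
      and Q: "Q \<in> pol_on (sites a2 b2)" "weyl_cong hbar (time_ordered Q) w" "h = emb Q"
      using fh by (auto simp: obs_class_def)
    from assms(4)[OF P(1) Q(1) P(2) Q(2)] show ?thesis
      by (auto simp: P(3) Q(3) coh_class_emb[OF assms(3)] obs_class_cong)
  qed
  moreover have "obs_class a1 b1 v \<noteq> {}" "obs_class a2 b2 w \<noteq> {}"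
    by (simp_all add: obs_class_nonempty assms(1,2))
  ultimately show ?thesis unfolding induced2_def by simp
qed

lemma incl_obs_class:
  assumes "b - a > 2" "d - c > 2" "sites a b \<subseteq> sites c d"
  shows "incl \<kappa> hbar \<alpha> c d (obs_class a b w) = obs_class c d w"
  unfolding incl_def using pol_on_mono[OF assms(3)]
  by (intro induced_obs_class assms) auto

text \<open>The value is unchanged by inclusion and determines the class in both intervals, so the
  inclusion is injective and its inverse keeps the value.\<close>

lemma inv_into_incl:
  assumes "b - a > 2" "d - c > 2" "sites a b \<subseteq> sites c d"
  shows "inv_into (H0 \<kappa> hbar \<alpha> a b) (incl \<kappa> hbar \<alpha> c d) (obs_class c d w) = obs_class a b w"
proof (rule inv_into_f_eq)
  show "inj_on (incl \<kappa> hbar \<alpha> c d) (H0 \<kappa> hbar \<alpha> a b)"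
    unfolding H0_eq[OF assms(1)]
    by (rule inj_onI, elim imageE) (simp add: incl_obs_class[OF assms] obs_class_eq_iff assms(1,2))
qed (auto simp: H0_eq assms(1) incl_obs_class[OF assms])

lemma sites_mono: "{a<..<b} \<subseteq> {c<..<d} \<Longrightarrow> sites a b \<subseteq> sites c d"
  unfolding sites_def by auto

lemma star_obs_class:
  assumes "{a1<..<b1} \<subseteq> {-4<..<4}" "b1 - a1 > 2" "{a2<..<b2} \<subseteq> {-4<..<4}" "b2 - a2 > 2" "b1 \<le> a2"
  shows "star \<kappa> hbar \<alpha> a1 b1 a2 b2 (obs_class (- 4) 4 v) (obs_class (- 4) 4 w) = obs_class (- 4) 4 (v * w)"
proof -
  note sub = sites_mono[OF assms(1)] sites_mono[OF assms(3)]
  \<comment> \<open>The cut is the last integer strictly below b1. Sites of the second interval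
    exceed a2 >= b1 and so lie beyond it, also when b1 is an integer.\<close>
  have "sites a1 b1 \<subseteq> {..\<lceil>b1\<rceil> - 1}" "sites a2 b2 \<subseteq> {\<lceil>b1\<rceil> - 1 + 1..}"
    using assms(5) unfolding sites_def by (auto; linarith)+
  then have "time_ordered (P * Q) = time_ordered P * time_ordered Q"
    if "P \<in> pol_on (sites a1 b1)" "Q \<in> pol_on (sites a2 b2)" for P Q
    using that pol_on_mono time_ordered_mult by meson
  then have "induced2 \<kappa> hbar \<alpha> (- 4) 4 (\<cdot>\<^sub>s) (obs_class a1 b1 v) (obs_class a2 b2 w) = obs_class (- 4) 4 (v * w)"
    using pol_on_mono[OF sub(1)] pol_on_mono[OF sub(2)]
    by (intro induced2_obs_class assms)
      (auto simp: smul_emb intro!: bexI[of _ "P * Q" for P Q] pol_on_mult weyl_cong_mult)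
  then show ?thesis
    unfolding star_def using inv_into_incl[OF _ _ sub(1)] inv_into_incl[OF _ _ sub(2)] assms by simp
qed

lemma shift_emb: "shift n (emb P) = emb (shift_pol n P)"
  by (cases "P = 0") (simp_all add: shift_def linear_pm_zero[OF linear_pm_shift_pol])

lemma translation_obs_class:
  assumes "{-4<..<4} \<union> {-3<..<5} \<subseteq> {a'<..<b'}"
  shows "translation \<kappa> hbar \<alpha> a' b' (obs_class (- 4) 4 w) = obs_class (- 4) 4 (weyl_step w)"
proof -
  have sub: "sites (- 4) 4 \<subseteq> sites a' b'" "sites (- 3) 5 \<subseteq> sites a' b'"
    using assms by (auto intro!: sites_mono)
  have "a' \<le> -4" "5 \<le> b'"
    using assms greaterThanLessThan_subseteq_greaterThanLessThan[of "-4" 4 a' b']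
      greaterThanLessThan_subseteq_greaterThanLessThan[of "-3" 5 a' b'] by auto
  then have len: "b' - a' > 2" by simp
  have "(\<lambda>x. x + 1) ` sites (- 4) 4 \<subseteq> sites (- 3) 5"
    unfolding sites_def by auto
  then have "induced \<kappa> hbar \<alpha> (- 3) 5 (shift 1) (obs_class (- 4) 4 w) = obs_class (- 3) 5 (weyl_step w)"
    by (intro induced_obs_class)
      (auto simp: shift_emb time_ordered_shift weyl_step_cong
        intro: pol_on_mono[OF _ pol_on_shift_pol])
  then show ?thesis
    unfolding translation_def
    using incl_obs_class[OF _ len sub(2)] inv_into_incl[OF _ len sub(1)] by simp
qed

end


section \<open>Isomorphisms of algebras\<close>

lemma algebra_isoI:
  assumes "\<And>x. x \<in> carrier M \<Longrightarrow> h x \<in> carrier N" "bij_betw h (carrier M) (carrier N)"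
    and "\<And>x y. x \<in> carrier M \<Longrightarrow> y \<in> carrier M \<Longrightarrow> h (x \<otimes>\<^bsub>M\<^esub> y) = h x \<otimes>\<^bsub>N\<^esub> h y"
    and "\<And>x y. x \<in> carrier M \<Longrightarrow> y \<in> carrier M \<Longrightarrow> h (x \<oplus>\<^bsub>M\<^esub> y) = h x \<oplus>\<^bsub>N\<^esub> h y"
    and "h \<one>\<^bsub>M\<^esub> = \<one>\<^bsub>N\<^esub>"
    and "\<And>c x. x \<in> carrier M \<Longrightarrow> h (c \<odot>\<^bsub>M\<^esub> x) = c \<odot>\<^bsub>N\<^esub> h x"
  shows "h \<in> algebra_iso M N"
  using assms by (auto simp: algebra_iso_def ring_iso_def intro: ring_hom_memI)

lemma algebra_isoD:
  assumes "h \<in> algebra_iso M N"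
  shows "bij_betw h (carrier M) (carrier N)"
    and "x \<in> carrier M \<Longrightarrow> h x \<in> carrier N"
    and "x \<in> carrier M \<Longrightarrow> y \<in> carrier M \<Longrightarrow> h (x \<otimes>\<^bsub>M\<^esub> y) = h x \<otimes>\<^bsub>N\<^esub> h y"
    and "x \<in> carrier M \<Longrightarrow> y \<in> carrier M \<Longrightarrow> h (x \<oplus>\<^bsub>M\<^esub> y) = h x \<oplus>\<^bsub>N\<^esub> h y"
    and "h \<one>\<^bsub>M\<^esub> = \<one>\<^bsub>N\<^esub>"
    and "x \<in> carrier M \<Longrightarrow> h (c \<odot>\<^bsub>M\<^esub> x) = c \<odot>\<^bsub>N\<^esub> h x"
  using assms by (auto simp: algebra_iso_def ring_iso_def ring_hom_def)

lemma algebra_iso_trans: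
  assumes "h \<in> algebra_iso L M" "k \<in> algebra_iso M N"
  shows "(\<lambda>x. k (h x)) \<in> algebra_iso L N"
  using algebra_isoD[OF assms(1)] algebra_isoD[OF assms(2)]
    bij_betw_trans[OF algebra_isoD(1)[OF assms(1)] algebra_isoD(1)[OF assms(2)]]
  by (intro algebra_isoI) (simp_all add: comp_def)

text \<open>Closure of M is assumed explicitly because M is a bare record, and h is inverted only on
  its carrier.\<close>

lemma algebra_iso_inv_into:
  assumes "h \<in> algebra_iso M N"
    and "\<And>x y. x \<in> carrier M \<Longrightarrow> y \<in> carrier M \<Longrightarrow> x \<otimes>\<^bsub>M\<^esub> y \<in> carrier M"
    and "\<And>x y. x \<in> carrier M \<Longrightarrow> y \<in> carrier M \<Longrightarrow> x \<oplus>\<^bsub>M\<^esub> y \<in> carrier M"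
    and "\<one>\<^bsub>M\<^esub> \<in> carrier M" "\<And>c x. x \<in> carrier M \<Longrightarrow> c \<odot>\<^bsub>M\<^esub> x \<in> carrier M"
  shows "inv_into (carrier M) h \<in> algebra_iso N M"
proof -
  note h = algebra_isoD[OF assms(1)]
  let ?k = "inv_into (carrier M) h"
  have kh: "?k (h x) = x" if "x \<in> carrier M" for x
    using that h(1) by (simp add: bij_betw_def)
  have ex: "\<exists>x\<in>carrier M. y = h x" if "y \<in> carrier N" for y
    using that h(1) by (auto simp: bij_betw_def)
  show ?thesis
  proof (rule algebra_isoI)
    show "bij_betw ?k (carrier N) (carrier M)" by (rule bij_betw_inv_into[OF h(1)])
    show "?k \<one>\<^bsub>N\<^esub> = \<one>\<^bsub>M\<^esub>" using kh[OF assms(4)] by (simp add: h(5))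
    fix y assume "y \<in> carrier N"
    then obtain x where x: "x \<in> carrier M" "y = h x" using ex by blast
    show "?k y \<in> carrier M" using x by (simp add: kh)
    show "?k (c \<odot>\<^bsub>N\<^esub> y) = c \<odot>\<^bsub>M\<^esub> ?k y" for c
      using x kh[OF assms(5)[OF x(1)], of c] by (simp add: kh h(6))
    fix y' assume "y' \<in> carrier N"
    then obtain x' where x': "x' \<in> carrier M" "y' = h x'" using ex by blast
    show "?k (y \<otimes>\<^bsub>N\<^esub> y') = ?k y \<otimes>\<^bsub>M\<^esub> ?k y'"
      using x x' kh[OF assms(2)[OF x(1) x'(1)]] by (simp add: kh h(3))
    show "?k (y \<oplus>\<^bsub>N\<^esub> y') = ?k y \<oplus>\<^bsub>M\<^esub> ?k y'"
      using x x' kh[OF assms(3)[OF x(1) x'(1)]] by (simp add: kh h(4))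
  qed
qed

section \<open>Operations of the Weyl algebra on representatives\<close>

lemma weyl_class_eq: "weyl_class hbar w = {v. weyl_cong hbar v w}"
proof -
  have "(\<lambda>i. i + w) ` weyl_ideal hbar = {v. v - w \<in> weyl_ideal hbar}"
    by (auto intro!: image_eqI[of _ _ "v - w" for v])
  then show ?thesis
    unfolding weyl_class_def a_r_coset_def r_coset_def weyl_cong_def by auto
qed

lemma weyl_class_eq_iff: "weyl_class hbar v = weyl_class hbar w \<longleftrightarrow> weyl_cong hbar v w"
  unfolding weyl_class_eq by (blast intro: weyl_cong_refl weyl_cong_sym weyl_cong_trans)

lemma weyl_algebra_sel:
  shows carrier_weyl_algebra: "carrier (weyl_algebra hbar) = range (weyl_class hbar)"
    and one_weyl_algebra: "\<one>\<^bsub>weyl_algebra hbar\<^esub> = weyl_class hbar 1"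
    and mult_weyl_algebra: "weyl_class hbar v \<otimes>\<^bsub>weyl_algebra hbar\<^esub> weyl_class hbar w = weyl_class hbar (v * w)"
    and add_weyl_algebra: "weyl_class hbar v \<oplus>\<^bsub>weyl_algebra hbar\<^esub> weyl_class hbar w = weyl_class hbar (v + w)"
    and smult_weyl_algebra: "c \<odot>\<^bsub>weyl_algebra hbar\<^esub> weyl_class hbar w = weyl_class hbar (const c * w)"
proof -
  interpret ideal "weyl_ideal hbar" ring_of_type_algebra by (rule ideal_weyl_ideal)
  show "carrier (weyl_algebra hbar) = range (weyl_class hbar)"
    by (auto simp: weyl_algebra_def ring.defs FactRing_def A_RCOSETS_def' weyl_class_def a_r_coset_def')
  show "\<one>\<^bsub>weyl_algebra hbar\<^esub> = weyl_class hbar 1"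
    by (simp add: weyl_algebra_def ring.defs FactRing_def weyl_class_def)
  show "weyl_class hbar v \<otimes>\<^bsub>weyl_algebra hbar\<^esub> weyl_class hbar w = weyl_class hbar (v * w)"
    using rcoset_mult_add[of v w] by (simp add: weyl_algebra_def ring.defs FactRing_def weyl_class_def)
  show "weyl_class hbar v \<oplus>\<^bsub>weyl_algebra hbar\<^esub> weyl_class hbar w = weyl_class hbar (v + w)"
    using a_rcos_sum[of v w] by (simp add: weyl_algebra_def ring.defs FactRing_def weyl_class_def)
  have "(\<Union>u\<in>weyl_class hbar w. weyl_class hbar (const c * u)) =
      (\<Union>u\<in>weyl_class hbar w. weyl_class hbar (const c * w))"
    by (rule SUP_cong[OF refl], unfold weyl_class_eq_iff)
      (simp add: weyl_class_eq weyl_cong_mult_left)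
  moreover have "weyl_class hbar w \<noteq> {}"
    unfolding weyl_class_eq using weyl_cong_refl by blast
  ultimately show "c \<odot>\<^bsub>weyl_algebra hbar\<^esub> weyl_class hbar w = weyl_class hbar (const c * w)"
    by (simp add: weyl_algebra_def ring.defs)
qed

section \<open>The identification with the Weyl algebra and the translation automorphism\<close>

context observables
begin

context
  fixes a1 b1 a2 b2 :: real
  assumes I1: "{a1<..<b1} \<subseteq> {-4<..<4}" "b1 - a1 > 2"
    and I2: "{a2<..<b2} \<subseteq> {-4<..<4}" "b2 - a2 > 2"
    and I1_left_of_I2: "b1 \<le> a2"
begin

abbreviation Obs :: "('r, 'r sym set) module" where
  "Obs \<equiv> obs_algebra \<kappa> hbar \<alpha> a1 b1 a2 b2"

abbreviation obs :: "'r free_alg \<Rightarrow> 'r sym set" where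
  "obs \<equiv> obs_class (- 4) 4"

lemma coh_class_J: "P \<in> pol_on (sites (- 4) 4) \<Longrightarrow> coh_class \<kappa> hbar \<alpha> (- 4) 4 (emb P) = obs (time_ordered P)"
  by (rule coh_class_emb) simp_all

lemma obs_eq_iff: "obs v = obs w \<longleftrightarrow> weyl_cong hbar v w"
  by (rule obs_class_eq_iff) simp

lemma obs_algebra_sel:
  shows carrier_Obs: "carrier Obs = range obs"
    and one_Obs: "\<one>\<^bsub>Obs\<^esub> = obs 1"
    and mult_Obs: "obs v \<otimes>\<^bsub>Obs\<^esub> obs w = obs (v * w)"
    and add_Obs: "obs v \<oplus>\<^bsub>Obs\<^esub> obs w = obs (v + w)"
    and smult_Obs: "c \<odot>\<^bsub>Obs\<^esub> obs w = obs (const c * w)"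
proof -
  show "carrier Obs = range obs" by (simp add: obs_algebra_def H0_eq)
  show "\<one>\<^bsub>Obs\<^esub> = obs 1"
    using coh_class_J[of 1] time_ordered_const[of 1] pol_on_const[of 1 "sites (- 4) 4"]
    by (simp add: obs_algebra_def scalar_def)
  show "obs v \<otimes>\<^bsub>Obs\<^esub> obs w = obs (v * w)"
    using star_obs_class[OF I1 I2 I1_left_of_I2] by (simp add: obs_algebra_def)
  show "obs v \<oplus>\<^bsub>Obs\<^esub> obs w = obs (v + w)"
    unfolding obs_algebra_def ring.simps
    by (rule induced2_obs_class)
      (auto simp: linear_pm_add[OF linear_pm_time_ordered] weyl_cong_add simp flip: single_add intro: pol_on_add)
  show "c \<odot>\<^bsub>Obs\<^esub> obs w = obs (const c * w)"
    unfolding obs_algebra_def module.simps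
    by (rule induced_obs_class)
      (auto simp: scalar_smul_emb linear_pm_scale[OF linear_pm_time_ordered] weyl_cong_mult_left intro: pol_on_mult)
qed

lemma coh_class_q: "coh_class \<kappa> hbar \<alpha> (- 4) 4 (lin (delta 0)) = obs free_q"
proof -
  have "(gen 0 :: 'r pol) \<in> pol_on (sites (- 4) 4)" by (rule pol_on_gen) (simp add: sites_def)
  then have "coh_class \<kappa> hbar \<alpha> (- 4) 4 (lin (delta 0)) = obs (hat 0)"
    unfolding lin_delta by (simp only: coh_class_J time_ordered_gen)
  then show ?thesis by (simp add: hat_def)
qed

text \<open>The q-coefficients of \<open>hat 1\<close> and \<open>hat (- 1)\<close> agree and their
  p-coefficients are 1 and -1, so the difference is twice p.\<close>

lemma coh_class_p:
  "coh_class \<kappa> hbar \<alpha> (- 4) 4 (scalar (\<kappa> (1 / 2)) \<cdot>\<^sub>s (lin (delta 1) - lin (delta (- 1)))) = obs free_p"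
proof -
  let ?h = "\<kappa> (1 / 2)" and ?P = "gen 1 - gen (- 1) :: 'r pol"
  have c: "q_coeff 1 = g" "p_coeff 1 = 1" "q_coeff (- 1) = g" "p_coeff (- 1) = - 1"
    using qp_coeff_succ[of 0] qp_coeff_pred[of 0] by simp_all
  have "const ?h * ?P \<in> pol_on (sites (- 4) 4)"
    by (intro pol_on_mult pol_on_diff pol_on_gen pol_on_const) (simp_all add: sites_def)
  then have "coh_class \<kappa> hbar \<alpha> (- 4) 4 (emb (const ?h * ?P)) = obs (const ?h * (hat 1 - hat (- 1)))"
    by (simp only: coh_class_J linear_pm_scale[OF linear_pm_time_ordered]
        linear_pm_minus[OF linear_pm_time_ordered] time_ordered_gen)
  also have "const ?h * (hat 1 - hat (- 1)) = const (?h + ?h) * free_p"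
  proof -
    have "hat 1 - hat (- 1) = free_p + free_p"
      by (simp add: hat_def c single_uminus)
    then show ?thesis by (simp only: single_add distrib_left distrib_right)
  qed
  also have "\<dots> = free_p" by (simp add: \<kappa>_half)
  finally show ?thesis
    unfolding lin_delta single_diff[symmetric] scalar_smul_emb .
qed

text \<open>An element of the Weyl algebra is itself a set of admissible values, so its preimage
  gives the class without choosing a representative.\<close>

definition weyl_to_obs :: "'r free_alg set \<Rightarrow> 'r sym set" where
  "weyl_to_obs U = emb ` {P \<in> pol_on (sites (- 4) 4). time_ordered P \<in> U}"

lemma weyl_to_obs_class: "weyl_to_obs (weyl_class hbar w) = obs w"
  by (simp add: weyl_to_obs_def weyl_class_eq obs_class_def)

lemma weyl_identification_weyl_to_obs:
  "weyl_identification \<kappa> hbar \<alpha> a1 b1 a2 b2 weyl_to_obs"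
proof -
  have "weyl_to_obs \<in> algebra_iso (weyl_algebra hbar) Obs"
  proof (rule algebra_isoI)
    show "bij_betw weyl_to_obs (carrier (weyl_algebra hbar)) (carrier Obs)"
      by (rule bij_betw_imageI)
        (auto simp: inj_on_def carrier_weyl_algebra carrier_Obs weyl_to_obs_class obs_eq_iff weyl_class_eq_iff image_image)
  qed (auto simp: carrier_weyl_algebra carrier_Obs weyl_to_obs_class mult_weyl_algebra mult_Obs
      add_weyl_algebra add_Obs one_weyl_algebra one_Obs smult_weyl_algebra smult_Obs)
  then show ?thesis
    unfolding weyl_identification_def weyl_q_def weyl_p_def
    by (simp only: weyl_to_obs_class coh_class_q coh_class_p simp_thms)
qed

context
  fixes a' b' :: real
  assumes J': "{-4<..<4} \<union> {-3<..<5} \<subseteq> {a'<..<b'}"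
begin

abbreviation step_Obs :: "'r sym set \<Rightarrow> 'r sym set" where
  "step_Obs \<equiv> translation \<kappa> hbar \<alpha> a' b'"

lemma step_Obs_obs: "step_Obs (obs w) = obs (weyl_step w)"
  by (rule translation_obs_class[OF J'])

text \<open>On values, translation is the substitution \<open>weyl_step\<close>; bijectivity comes
  from the inverse substitution, which also respects the Weyl relation.\<close>

lemma translation_algebra_iso: "step_Obs \<in> algebra_iso Obs Obs"
proof (rule algebra_isoI)
  have "weyl_cong hbar v w" if "weyl_cong hbar (weyl_step v) (weyl_step w)" for v w
    using weyl_step_back_cong[OF that] by simp
  moreover have "range (\<lambda>w. obs (weyl_step w)) = range obs"
  proof (intro equalityI subsetI)
    fix U assume "U \<in> range obs"
    then obtain w where "U = obs w" by blast
    then show "U \<in> range (\<lambda>w. obs (weyl_step w))"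
      by (intro image_eqI[of _ _ "weyl_step_back w"]) simp_all
  qed blast
  ultimately show "bij_betw step_Obs (carrier Obs) (carrier Obs)"
    by (intro bij_betw_imageI)
      (auto simp: inj_on_def carrier_Obs step_Obs_obs obs_eq_iff image_image)
qed (auto simp: carrier_Obs step_Obs_obs mult_Obs add_Obs one_Obs smult_Obs
    weyl_step_def linear_pm_scale[OF linear_pm_free_subst])

text \<open>For arbitrary \<phi>, the two images are compared after applying \<phi>, where
  translation is \<open>weyl_step\<close> and the values of \<phi> at q and p are known; then \<phi>
  is cancelled on the carrier.\<close>

lemma weyl_translation:
  assumes "weyl_identification \<kappa> hbar \<alpha> a1 b1 a2 b2 \<phi>"
  defines "W \<equiv> weyl_algebra hbar" and "\<Theta> \<equiv> weyl_translation \<kappa> hbar \<alpha> a' b' \<phi>"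
  shows "\<Theta> \<in> algebra_iso W W"
    and "\<Theta> (weyl_q hbar) = g \<odot>\<^bsub>W\<^esub> weyl_q hbar \<oplus>\<^bsub>W\<^esub> weyl_p hbar"
    and "\<Theta> (weyl_p hbar) = (g\<^sup>2 - 1) \<odot>\<^bsub>W\<^esub> weyl_q hbar \<oplus>\<^bsub>W\<^esub> g \<odot>\<^bsub>W\<^esub> weyl_p hbar"
proof -
  have \<phi>: "\<phi> \<in> algebra_iso W Obs" and \<phi>_gen: "\<phi> (weyl_q hbar) = obs free_q" "\<phi> (weyl_p hbar) = obs free_p"
    using assms(1) unfolding weyl_identification_def by (simp_all only: W_def coh_class_q coh_class_p)
  note W_simps = weyl_algebra_sel[of hbar, folded W_def]
  have \<Theta>: "\<Theta> = (\<lambda>w. inv_into (carrier W) \<phi> (step_Obs (\<phi> w)))"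
    by (rule ext) (simp add: \<Theta>_def weyl_translation_def W_def)
  have "inv_into (carrier W) \<phi> \<in> algebra_iso Obs W"
    by (rule algebra_iso_inv_into[OF \<phi>]) (auto simp: W_simps)
  then show "\<Theta> \<in> algebra_iso W W"
    unfolding \<Theta> using algebra_iso_trans[OF algebra_iso_trans[OF \<phi> translation_algebra_iso]] by blast
  have gens: "weyl_q hbar \<in> carrier W" "weyl_p hbar \<in> carrier W"
    by (simp_all add: W_simps weyl_q_def weyl_p_def)
  have closed: "c \<odot>\<^bsub>W\<^esub> weyl_q hbar \<in> carrier W" "c \<odot>\<^bsub>W\<^esub> weyl_p hbar \<in> carrier W"
    "c \<odot>\<^bsub>W\<^esub> weyl_q hbar \<oplus>\<^bsub>W\<^esub> weyl_p hbar \<in> carrier W"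
    "c \<odot>\<^bsub>W\<^esub> weyl_q hbar \<oplus>\<^bsub>W\<^esub> d \<odot>\<^bsub>W\<^esub> weyl_p hbar \<in> carrier W" for c d
    by (simp_all add: W_simps weyl_q_def weyl_p_def)
  have inv: "inv_into (carrier W) \<phi> (\<phi> x) = x" if "x \<in> carrier W" for x
    using that algebra_isoD(1)[OF \<phi>] by (simp add: bij_betw_def)
  have "step_Obs (\<phi> (weyl_q hbar)) = obs (const g * free_q + free_p)"
    by (simp add: \<phi>_gen step_Obs_obs weyl_step_def step_subst_def)
  also have "\<dots> = \<phi> (g \<odot>\<^bsub>W\<^esub> weyl_q hbar \<oplus>\<^bsub>W\<^esub> weyl_p hbar)"
    by (simp add: algebra_isoD[OF \<phi>] gens closed \<phi>_gen add_Obs smult_Obs)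
  finally show "\<Theta> (weyl_q hbar) = g \<odot>\<^bsub>W\<^esub> weyl_q hbar \<oplus>\<^bsub>W\<^esub> weyl_p hbar"
    unfolding \<Theta> by (simp only: inv closed)
  have "step_Obs (\<phi> (weyl_p hbar)) = obs (const (g\<^sup>2 - 1) * free_q + const g * free_p)"
    by (simp add: \<phi>_gen step_Obs_obs weyl_step_def step_subst_def)
  also have "\<dots> = \<phi> ((g\<^sup>2 - 1) \<odot>\<^bsub>W\<^esub> weyl_q hbar \<oplus>\<^bsub>W\<^esub> g \<odot>\<^bsub>W\<^esub> weyl_p hbar)"
    by (simp add: algebra_isoD[OF \<phi>] gens closed \<phi>_gen add_Obs smult_Obs)
  finally show "\<Theta> (weyl_p hbar) = (g\<^sup>2 - 1) \<odot>\<^bsub>W\<^esub> weyl_q hbar \<oplus>\<^bsub>W\<^esub> g \<odot>\<^bsub>W\<^esub> weyl_p hbar"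
    unfolding \<Theta> by (simp only: inv closed)
qed

end

end

end

theorem lemma4p5:
  fixes \<kappa> :: "'k::field_char_0 \<Rightarrow> 'r::comm_ring_1"
    and hbar :: 'r and \<alpha> :: 'k and a1 b1 a2 b2 a' b' :: real
  assumes scalars: "scalar_extension \<kappa> hbar"
    and \<alpha>: "\<alpha> \<noteq> 0"
    and I1: "{a1<..<b1} \<subseteq> {-4<..<4}" "b1 - a1 > 2"
    and I2: "{a2<..<b2} \<subseteq> {-4<..<4}" "b2 - a2 > 2"
    and I1_left_of_I2: "b1 \<le> a2"
    and J': "{-4<..<4} \<union> {-3<..<5} \<subseteq> {a'<..<b'}"
  shows "(\<exists>\<phi>. weyl_identification \<kappa> hbar \<alpha> a1 b1 a2 b2 \<phi>) \<and>
    (\<forall>\<phi>. weyl_identification \<kappa> hbar \<alpha> a1 b1 a2 b2 \<phi> \<longrightarrow>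
      (let W = weyl_algebra hbar; \<Theta> = weyl_translation \<kappa> hbar \<alpha> a' b' \<phi> in
        \<Theta> \<in> algebra_iso W W \<and>
        \<Theta> (weyl_q hbar) =
          \<kappa> ((\<alpha> + inverse \<alpha>) / 2) \<odot>\<^bsub>W\<^esub> weyl_q hbar \<oplus>\<^bsub>W\<^esub> weyl_p hbar \<and>
        \<Theta> (weyl_p hbar) =
          \<kappa> (((\<alpha> - inverse \<alpha>) / 2)\<^sup>2) \<odot>\<^bsub>W\<^esub> weyl_q hbar \<oplus>\<^bsub>W\<^esub>
          \<kappa> ((\<alpha> + inverse \<alpha>) / 2) \<odot>\<^bsub>W\<^esub> weyl_p hbar))"
proof -
  interpret observables "\<kappa> ((\<alpha> + inverse \<alpha>) / 2)" hbar \<kappa> \<alpha>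
    using scalars \<alpha> by unfold_locales (simp_all add: scalar_extension_def)
  show ?thesis
    using weyl_identification_weyl_to_obs[OF I1 I2 I1_left_of_I2]
      weyl_translation[OF I1 I2 I1_left_of_I2 J']
    unfolding Let_def \<kappa>_discriminant by blast
qed

end
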